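(* Let $1\le p<+\infty$, $\alpha>-1$ and $0<r<1$. There exist constants $L>0$ and $c>0$, depending on $r$ (and on $p$ and $\alpha$), such that for every $\gamma>0$, every measurable set $E\subset\mathbb{D}$ which is $(\gamma,r)$-dense, and every $f\in A^{p,\alpha}(\mathbb{D})$, $$\|f\|_{L^{p,\alpha}(E)}\ge\left(\frac{\gamma}{c}\right)^{L}\|f\|_{A^{p,\alpha}}.$$
   Context: $\mathbb{D}$ is the open unit disk in $\mathbb{C}$, $dA$ is normalized Lebesgue area measure on $\mathbb{D}$ (so $A(\mathbb{D})=1$), and $dA_\alpha(z)=(\alpha+1)(1-|z|^2)^\alpha\,dA(z)$. The weighted Bergman space $A^{p,\alpha}(\mathbb{D})$ is the space of holomorphic functions $f$ on $\mathbb{D}$ with $\|f\|_{A^{p,\alpha}}^p=\int_{\mathbb{D}}|f|^p\,dA_\alpha<+\infty$. For a measurable set $F\subset\mathbb{D}$, $\|f\|_{L^{p,\alpha}(F)}^p=\int_F|f|^p\,dA_\alpha$. The pseudohyperbolic distance on $\mathbb{D}$ is $\rho(z,w)=\left|\frac{z-w}{1-\overline{z}w}\right|$, and $D_{phb}(z,r)=\{w\in\mathbb{D}:\rho(z,w)<r\}$ for $0<r<1$. A measurable set $E\subset\mathbb{D}$ is called $(\gamma,r)$-dense, for $\gamma>0$ and $0<r<1$, if for every $z\in\mathbb{D}$ $$\frac{|E\cap D_{phb}(z,r)|}{|D_{phb}(z,r)|}\ge\gamma,$$ where $|F|$ denotes the planar Lebesgue measure of $F$. *)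

theory Defs
  imports "HOL-Analysis.Analysis"
begin

abbreviation unit_disk :: "complex set" where
  "unit_disk \<equiv> ball 0 1"

definition area_measure :: "complex measure" where
  "area_measure = uniform_measure lebesgue unit_disk"

(* The formula matters only on the unit disk, since area_measure vanishes outside it. *)
definition weighted_area_measure :: "real \<Rightarrow> complex measure" where
  "weighted_area_measure \<alpha> =
     density area_measure (\<lambda>z. ennreal ((\<alpha> + 1) * (1 - (cmod z)\<^sup>2) powr \<alpha>))"

definition weighted_integral :: "real \<Rightarrow> real \<Rightarrow> complex set \<Rightarrow> (complex \<Rightarrow> complex) \<Rightarrow> ennreal" where
  "weighted_integral p \<alpha> F f =
     (\<integral>\<^sup>+z\<in>F. ennreal (cmod (f z) powr p) \<partial>weighted_area_measure \<alpha>)"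

(* enn2real sends infinity to 0, so this is the L^p norm only when the integral is finite,
   in particular for functions in bergman_space and F contained in the unit disk. *)
definition weighted_norm :: "real \<Rightarrow> real \<Rightarrow> complex set \<Rightarrow> (complex \<Rightarrow> complex) \<Rightarrow> real" where
  "weighted_norm p \<alpha> F f = enn2real (weighted_integral p \<alpha> F f) powr (1 / p)"

(* Functions are total; their values outside the unit disk are arbitrary and never used. *)
definition bergman_space :: "real \<Rightarrow> real \<Rightarrow> (complex \<Rightarrow> complex) set" where
  "bergman_space p \<alpha> =
     {f. f holomorphic_on unit_disk \<and> weighted_integral p \<alpha> unit_disk f < \<infinity>}"

definition bergman_norm :: "real \<Rightarrow> real \<Rightarrow> (complex \<Rightarrow> complex) \<Rightarrow> real" where
  "bergman_norm p \<alpha> f = weighted_norm p \<alpha> unit_disk f"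

definition pseudohyperbolic_dist :: "complex \<Rightarrow> complex \<Rightarrow> real" where
  "pseudohyperbolic_dist z w = cmod ((z - w) / (1 - cnj z * w))"

definition pseudohyperbolic_disk :: "complex \<Rightarrow> real \<Rightarrow> complex set" where
  "pseudohyperbolic_disk z r = {w \<in> unit_disk. pseudohyperbolic_dist z w < r}"

definition pseudohyperbolic_dense :: "real \<Rightarrow> real \<Rightarrow> complex set \<Rightarrow> bool" where
  "pseudohyperbolic_dense \<gamma> r E \<longleftrightarrow>
     (\<forall>z\<in>unit_disk.
        measure lebesgue (E \<inter> pseudohyperbolic_disk z r) / measure lebesgue (pseudohyperbolic_disk z r)
          \<ge> \<gamma>)"

end

theory Submission
  imports Defs "HOL-Complex_Analysis.Complex_Analysis"
begin

text \<open>
  Write \<open>d(z) = 1 - |z|^2\<close>. A point \<open>w\<close> of the disk is good for \<open>f\<close> if the average of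
  \<open>|f|^p d^\<alpha>\<close> over a fixed large pseudohyperbolic neighbourhood of \<open>w\<close> is at most a constant
  times the value at \<open>w\<close> itself. By Tonelli the averages integrate to a multiple of the norm, so
  the bad points carry at most half of the norm, whatever \<open>f\<close> is. It therefore suffices to
  estimate \<open>|f(w)|^p\<close> at a good point by the integral of \<open>|f|^p\<close> over the part of \<open>E\<close> near \<open>w\<close>, and
  to integrate over \<open>w\<close> once more (lemma \<open>weighted_integral_lower_bound\<close>).

  At a good point \<open>f\<close> is, near \<open>w\<close>, bounded by a constant multiple of \<open>M = |f(w)|\<close>. Such a function
  behaves like a polynomial of bounded degree: its Taylor tail is negligible, so one of finitely
  many Taylor coefficients is not small (\<open>large_Taylor_coefficient\<close>), and dividing out one point
  of the sublevel set after another shows that, in a disk of small radius, \<open>{|f| \<le> c \<delta>^N M}\<close> is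
  covered by \<open>N\<close> disks whose radius is proportional to \<open>\<delta>\<close>
  (\<open>sublevel_set_cover_of_large_coefficient\<close>). This replaces a Remez inequality and gives the polynomial dependence on \<open>\<gamma>\<close>: as \<open>E\<close> has density \<open>\<gamma>\<close>, the choice of \<open>\<delta>\<close> proportional
  to \<open>\<gamma>\<close> leaves at least half of a suitable piece of \<open>E\<close> near \<open>w\<close> outside the sublevel set, where \<open>|f|^p\<close> is at least a
  multiple of \<open>\<gamma>^{N p} M^p\<close> (\<open>local_lower_bound\<close>).

  The covering argument works only in small disks, whereas \<open>r\<close> may be close to 1. The density
  assumption is therefore first localised, by pigeonhole, to a small disk around some \<open>a\<close> within
  pseudohyperbolic distance \<open>r\<close> of \<open>w\<close> (\<open>concentration_in_small_ball\<close>), and the lower bound at \<open>w\<close>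
  is transported to that disk by expanding \<open>f\<close> in the Moebius coordinate centred at \<open>a\<close>
  (\<open>propagation_of_smallness\<close>).
\<close>

section \<open>Pseudohyperbolic geometry in Euclidean terms\<close>

definition disk_defect :: "complex \<Rightarrow> real" where
  "disk_defect z = 1 - (cmod z)\<^sup>2"

text \<open>
  A Euclidean substitute for a pseudohyperbolic distance bounded away from 1: the distance of the
  points is at most of the order of their distances to the unit circle. In this form symmetry, transitivity
  and comparability of \<open>disk_defect\<close> need no hyperbolic trigonometry.
\<close>
definition near :: "real \<Rightarrow> complex \<Rightarrow> complex \<Rightarrow> bool" where
  "near A w z \<longleftrightarrow> w \<in> unit_disk \<and> z \<in> unit_disk \<and>
     cmod (w - z) \<le> A * disk_defect w \<and> cmod (w - z) \<le> A * disk_defect z"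

lemma disk_defect_pos: "z \<in> unit_disk \<Longrightarrow> 0 < disk_defect z"
  by (simp add: disk_defect_def power_less_one_iff abs_square_less_1)

lemma disk_defect_Lipschitz:
  assumes "w \<in> unit_disk" "z \<in> unit_disk"
  shows "disk_defect z \<le> disk_defect w + 2 * cmod (w - z)"
proof -
  have "(cmod w)\<^sup>2 - (cmod z)\<^sup>2 = (cmod w - cmod z) * (cmod w + cmod z)"
    by (simp add: power2_eq_square algebra_simps)
  also have "\<dots> \<le> cmod (w - z) * 2"
    using assms norm_triangle_ineq2[of w z]
    by (intro mult_mono) auto
  finally show ?thesis by (simp add: disk_defect_def)
qed

lemma near_sym: "near A w z \<longleftrightarrow> near A z w"
  by (auto simp: near_def norm_minus_commute)

lemma near_disk_defect_le: "near A w z \<Longrightarrow> disk_defect z \<le> (1 + 2 * A) * disk_defect w"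
  using disk_defect_Lipschitz[of w z] by (auto simp: near_def algebra_simps)

lemma near_mono:
  assumes "near A w z" "A \<le> B"
  shows "near B w z"
proof -
  have "A * disk_defect w \<le> B * disk_defect w" "A * disk_defect z \<le> B * disk_defect z"
    using assms disk_defect_pos[of w] disk_defect_pos[of z] by (auto simp: near_def intro!: mult_right_mono)
  then show ?thesis using assms(1) by (auto simp: near_def)
qed

lemma near_trans:
  assumes "near A w a" "near B a z" "0 \<le> A" "0 \<le> B"
  shows "near (A + B + 2 * A * B) w z"
proof -
  have *: "cmod (w - z) \<le> cmod (w - a) + cmod (a - z)"
    using norm_triangle_ineq[of "w - a" "a - z"] by simp
  have "B * disk_defect a \<le> B * ((1 + 2 * A) * disk_defect w)"
    using near_disk_defect_le[OF assms(1)] assms by (intro mult_left_mono) auto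
  moreover have "A * disk_defect a \<le> A * ((1 + 2 * B) * disk_defect z)"
    using near_disk_defect_le[of B z a] assms by (intro mult_left_mono) (auto simp: near_sym)
  ultimately show ?thesis using * assms by (auto simp: near_def algebra_simps)
qed

text \<open>
  A Euclidean disk around \<open>a\<close> of radius a quarter of \<open>disk_defect a\<close> keeps away from the circle,
  because \<open>disk_defect a\<close> is at most twice the distance of \<open>a\<close> to the circle.
\<close>
lemma near_ball:
  assumes "a \<in> unit_disk" "cmod (z - a) < disk_defect a / 4"
  shows "near (1/2) a z"
proof -
  have "disk_defect a = (1 - cmod a) * (1 + cmod a)"
    by (simp add: disk_defect_def power2_eq_square algebra_simps)
  also have "\<dots> \<le> (1 - cmod a) * 2" using assms(1) by (intro mult_left_mono) auto
  finally have "cmod z < 1"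
    using assms norm_triangle_sub[of z a] disk_defect_pos[OF assms(1)] by auto
  moreover have "disk_defect a \<le> disk_defect z + 2 * cmod (z - a)"
    using disk_defect_Lipschitz[of z a] assms(1) \<open>cmod z < 1\<close> by simp
  ultimately show ?thesis
    using assms disk_defect_pos[OF assms(1)] by (simp add: near_def norm_minus_commute)
qed

text \<open>
  The classical identity expressing \<open>1 - \<rho>(w,z)^2\<close> as
  \<open>(1 - |w|^2) (1 - |z|^2) / |1 - cnj w * z|^2\<close>, with the denominators cleared.
\<close>
lemma moebius_identity:
  "(cmod (1 - cnj w * z))\<^sup>2 - (cmod (w - z))\<^sup>2 = disk_defect w * disk_defect z"
proof -
  have "complex_of_real ((cmod (1 - cnj w * z))\<^sup>2 - (cmod (w - z))\<^sup>2)
      = complex_of_real (disk_defect w * disk_defect z)"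
    unfolding disk_defect_def of_real_diff of_real_mult complex_norm_square of_real_1
    by (simp add: algebra_simps)
  then show ?thesis by (simp only: of_real_eq_iff)
qed

lemma denominator_nonzero:
  assumes "w \<in> unit_disk" "z \<in> unit_disk"
  shows "1 - cnj w * z \<noteq> 0"
proof
  assume "1 - cnj w * z = 0"
  then have "disk_defect w * disk_defect z = - (cmod (w - z))\<^sup>2"
    using moebius_identity[of w z] by simp
  then have "disk_defect w * disk_defect z \<le> 0" by simp
  moreover have "0 < disk_defect w * disk_defect z"
    using assms by (intro mult_pos_pos disk_defect_pos)
  ultimately show False by simp
qed

text \<open>
  Both bounds come from \<open>1 - cnj w * z = (1 - |w|^2) + cnj w * (w - z)\<close>.
\<close>
lemma denominator_le:
  assumes "w \<in> unit_disk"
  shows "cmod (1 - cnj w * z) \<le> disk_defect w + cmod (w - z)"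
    and "disk_defect w - cmod (w - z) \<le> cmod (1 - cnj w * z)"
proof -
  have eq: "1 - cnj w * z = of_real (disk_defect w) + cnj w * (w - z)"
    unfolding disk_defect_def of_real_diff complex_norm_square by (simp add: algebra_simps)
  have "cmod (cnj w * (w - z)) \<le> 1 * cmod (w - z)"
    unfolding norm_mult using assms by (intro mult_right_mono) auto
  moreover have "cmod (of_real (disk_defect w)) = disk_defect w"
    using disk_defect_pos[OF assms] by simp
  ultimately show "cmod (1 - cnj w * z) \<le> disk_defect w + cmod (w - z)"
    "disk_defect w - cmod (w - z) \<le> cmod (1 - cnj w * z)"
    unfolding eq using norm_triangle_ineq[of "of_real (disk_defect w)" "cnj w * (w - z)"]
      norm_diff_ineq[of "of_real (disk_defect w)" "cnj w * (w - z)"] by simp_all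
qed

lemma pseudohyperbolic_dist_commute: "pseudohyperbolic_dist w z = pseudohyperbolic_dist z w"
proof -
  have "cmod (1 - cnj w * z) = cmod (cnj (1 - cnj w * z))" by (rule complex_mod_cnj[symmetric])
  also have "cnj (1 - cnj w * z) = 1 - cnj z * w" by (simp add: mult.commute)
  finally show ?thesis
    by (simp add: pseudohyperbolic_dist_def norm_divide norm_minus_commute)
qed

lemma pseudohyperbolic_dist_le_iff:
  assumes "w \<in> unit_disk" "z \<in> unit_disk"
  shows "pseudohyperbolic_dist w z \<le> s \<longleftrightarrow> cmod (w - z) \<le> s * cmod (1 - cnj w * z)"
  using denominator_nonzero[OF assms] by (simp add: pseudohyperbolic_dist_def norm_divide divide_le_eq)

lemma near_if_pseudohyperbolic_dist_le:
  assumes "w \<in> unit_disk" "z \<in> unit_disk" and s: "0 \<le> s" "s < 1"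
    and \<rho>: "pseudohyperbolic_dist w z \<le> s"
  shows "near (s / (1 - s)) w z"
proof -
  have "cmod (w - z) \<le> s / (1 - s) * disk_defect w"
    if "w \<in> unit_disk" "z \<in> unit_disk" "pseudohyperbolic_dist w z \<le> s" for w z
  proof -
    have "cmod (w - z) \<le> s * cmod (1 - cnj w * z)"
      using pseudohyperbolic_dist_le_iff that by blast
    also have "\<dots> \<le> s * (disk_defect w + cmod (w - z))"
      using denominator_le(1)[OF that(1)] s by (intro mult_left_mono) auto
    finally show ?thesis using s by (simp add: field_simps)
  qed
  from this[of w z] this[of z w] show ?thesis
    using assms by (auto simp: near_def pseudohyperbolic_dist_commute norm_minus_commute)
qed

lemma ball_subset_pseudohyperbolic_disk:
  assumes "w \<in> unit_disk" and r: "0 < r" "r < 1"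
  shows "ball w (r / 4 * disk_defect w) \<subseteq> pseudohyperbolic_disk w r"
proof
  fix z assume z: "z \<in> ball w (r / 4 * disk_defect w)"
  have d: "0 < disk_defect w" by (rule disk_defect_pos) fact
  have less: "cmod (w - z) < r / 4 * disk_defect w" using z by (simp add: dist_norm)
  also have "\<dots> \<le> disk_defect w / 4" using r d by simp
  finally have quarter: "cmod (w - z) < disk_defect w / 4" .
  then have zD: "z \<in> unit_disk"
    using near_ball[of w z] assms(1) by (simp add: norm_minus_commute near_def)
  have "r / 4 * disk_defect w < r * (disk_defect w / 2)" using r d by simp
  also have "\<dots> \<le> r * cmod (1 - cnj w * z)"
    using denominator_le(2)[OF assms(1), of z] quarter r d by (intro mult_left_mono) linarith+
  finally have "cmod (w - z) < r * cmod (1 - cnj w * z)" using less by linarith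
  then show "z \<in> pseudohyperbolic_disk w r"
    using denominator_nonzero[OF assms(1) zD] zD
    by (simp add: pseudohyperbolic_disk_def pseudohyperbolic_dist_def norm_divide divide_less_eq)
qed

text \<open>
  The Moebius involution of the disk that exchanges \<open>0\<close> and \<open>a\<close>. It carries the Euclidean disks
  around 0 to the pseudohyperbolic disks around \<open>a\<close>.
\<close>
definition disk_involution :: "complex \<Rightarrow> complex \<Rightarrow> complex" where
  "disk_involution a z = (a - z) / (1 - cnj a * z)"

lemma cmod_disk_involution: "cmod (disk_involution a z) = pseudohyperbolic_dist a z"
  by (simp add: disk_involution_def pseudohyperbolic_dist_def)

lemma disk_involution_in_disk:
  assumes "a \<in> unit_disk" "z \<in> unit_disk"
  shows "disk_involution a z \<in> unit_disk"
proof -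
  have "0 < disk_defect a * disk_defect z" using assms disk_defect_pos by (intro mult_pos_pos) auto
  then have "(cmod (a - z))\<^sup>2 < (cmod (1 - cnj a * z))\<^sup>2" using moebius_identity[of a z] by linarith
  then have "cmod (a - z) < cmod (1 - cnj a * z)" by (rule power_less_imp_less_base) simp
  then show ?thesis by (simp add: disk_involution_def norm_divide divide_less_eq)
qed

lemma disk_involution_involutive:
  assumes "a \<in> unit_disk" "z \<in> unit_disk"
  shows "disk_involution a (disk_involution a z) = z"
proof -
  have nz: "1 - cnj a * z \<noteq> 0" "1 - cnj a * a \<noteq> 0" using denominator_nonzero assms by blast+
  have "a - disk_involution a z = z * (1 - cnj a * a) / (1 - cnj a * z)"
    using nz(1) by (simp add: disk_involution_def field_simps)
  moreover have "1 - cnj a * disk_involution a z = (1 - cnj a * a) / (1 - cnj a * z)"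
    using nz(1) by (simp add: disk_involution_def field_simps)
  ultimately show ?thesis using nz by (simp add: disk_involution_def[of a "disk_involution a z"])
qed

lemma disk_involution_holomorphic: "a \<in> unit_disk \<Longrightarrow> disk_involution a holomorphic_on unit_disk"
  unfolding disk_involution_def using denominator_nonzero by (intro holomorphic_intros) auto

lemma near_disk_involution:
  assumes "a \<in> unit_disk" "cmod u \<le> s" "0 \<le> s" "s < 1"
  shows "near (s / (1 - s)) a (disk_involution a u)"
proof (rule near_if_pseudohyperbolic_dist_le)
  have u: "u \<in> unit_disk" using assms by simp
  show "disk_involution a u \<in> unit_disk" using disk_involution_in_disk assms(1) u .
  show "pseudohyperbolic_dist a (disk_involution a u) \<le> s"
    using disk_involution_involutive[OF assms(1) u] assms(2) by (simp flip: cmod_disk_involution)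
qed (use assms in auto)

lemma measurable_near [measurable]:
  "Measurable.pred (borel \<Otimes>\<^sub>M borel) (\<lambda>(w, z). near A w z)"
  unfolding near_def disk_defect_def mem_ball dist_norm by measurable

section \<open>Sublevel sets of holomorphic functions\<close>

text \<open>
  Away from \<open>t\<close> the quotient is bounded because its denominator is at least \<open>\<rho>\<close>; the maximum
  principle extends this bound into the disk around \<open>t\<close>. The quotient thus lives on the same set
  as \<open>h\<close>, which allows the construction to be iterated.
\<close>
lemma difference_quotient_holomorphic_bounded:
  assumes "open S" and h: "h holomorphic_on S" and M: "\<And>z. z \<in> S \<Longrightarrow> cmod (h z) \<le> M"
    and "\<rho> > 0" and cb: "cball t \<rho> \<subseteq> S"
  shows "\<exists>q. q holomorphic_on S \<and> (\<forall>z\<in>S. h z = h t + (z - t) * q z) \<and>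
           (\<forall>z\<in>S. cmod (q z) \<le> 2 * M / \<rho>)"
proof -
  define q where "q = (\<lambda>z. if z = t then deriv h t else (h z - h t) / (z - t))"
  have tS: "t \<in> S" using cb \<open>\<rho> > 0\<close> by auto
  have hol: "q holomorphic_on S"
    unfolding q_def by (rule pole_lemma[OF h]) (use tS \<open>open S\<close> in \<open>simp add: interior_open\<close>)
  have far: "cmod (q z) \<le> 2 * M / \<rho>" if z: "z \<in> S" "cmod (z - t) \<ge> \<rho>" for z
  proof -
    have "cmod (h z - h t) \<le> 2 * M"
      using norm_triangle_ineq4[of "h z" "h t"] M[OF z(1)] M[OF tS] by simp
    moreover have "z \<noteq> t" using z \<open>\<rho> > 0\<close> by auto
    moreover have "0 \<le> M" using M[OF tS] norm_ge_zero[of "h t"] by linarith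
    ultimately show ?thesis
      using z \<open>\<rho> > 0\<close> unfolding q_def by (auto simp: norm_divide intro!: frac_le)
  qed
  have near: "cmod (q z) \<le> 2 * M / \<rho>" if "z \<in> cball t \<rho>" for z
  proof (rule maximum_modulus_frontier[of q "cball t \<rho>"])
    show "q holomorphic_on interior (cball t \<rho>)"
      using hol cb interior_subset by (meson holomorphic_on_subset subset_trans)
    show "continuous_on (closure (cball t \<rho>)) q"
      using holomorphic_on_imp_continuous_on[OF holomorphic_on_subset[OF hol cb]] by simp
    fix z assume "z \<in> frontier (cball t \<rho>)"
    then have "cmod (z - t) = \<rho>" by (auto simp: dist_norm norm_minus_commute)
    moreover have "z \<in> S" using cb \<open>cmod (z - t) = \<rho>\<close> by (auto simp: dist_norm norm_minus_commute)
    ultimately show "cmod (q z) \<le> 2 * M / \<rho>" using far by simp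
  qed (use that in auto)
  show ?thesis
  proof (intro exI[of _ q] conjI ballI hol)
    show "h z = h t + (z - t) * q z" if "z \<in> S" for z
      unfolding q_def by auto
    show "cmod (q z) \<le> 2 * M / \<rho>" if "z \<in> S" for z
      using far[OF that] near[of z] by (cases "cmod (z - t) \<ge> \<rho>") (auto simp: dist_norm norm_minus_commute)
  qed
qed

lemma Cauchy_estimate_ball:
  assumes h: "h holomorphic_on ball 0 R" and M: "\<And>z. z \<in> ball 0 R \<Longrightarrow> cmod (h z) \<le> M"
    and "0 < s" "s < R"
  shows "cmod ((deriv ^^ n) h 0 / fact n) \<le> M / s ^ n"
proof -
  have sub: "cball 0 s \<subseteq> ball (0::complex) R" using \<open>s < R\<close> by auto
  have "cmod ((deriv ^^ n) h 0) \<le> fact n * M / s ^ n"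
  proof (rule Cauchy_inequality)
    show "h holomorphic_on ball 0 s" by (rule holomorphic_on_subset[OF h]) (use \<open>s < R\<close> in auto)
    show "continuous_on (cball 0 s) h"
      using holomorphic_on_imp_continuous_on[OF holomorphic_on_subset[OF h sub]] .
    show "cmod (h x) \<le> M" if "cmod (0 - x) = s" for x
      using that \<open>s < R\<close> by (intro M) simp
  qed fact
  then have "cmod ((deriv ^^ n) h 0) / fact n \<le> (fact n * M / s ^ n) / fact n"
    by (intro divide_right_mono) auto
  then show ?thesis by (simp add: norm_divide)
qed

text \<open>
  By Cauchy's estimates the part of the series beyond some index \<open>N\<close>, which depends only on \<open>s\<close>,
  \<open>R\<close> and \<open>K\<close>, contributes less than 1/2 on the disk of radius \<open>s\<close>. If the first coefficients were
  all tiny, the remaining part would contribute at most 1/2 too, and \<open>g\<close> could not reach 1 there.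
\<close>
lemma large_Taylor_coefficient:
  fixes s R K :: real
  assumes "0 < s" "s < R"
  shows "\<exists>N. \<exists>c>0. \<forall>g z0. g holomorphic_on ball 0 R \<longrightarrow> (\<forall>z\<in>ball 0 R. cmod (g z) \<le> K) \<longrightarrow>
           cmod z0 \<le> s \<longrightarrow> 1 \<le> cmod (g z0) \<longrightarrow>
           (\<exists>m\<le>N. c \<le> cmod ((deriv ^^ m) g 0 / fact m))"
proof -
  define t where "t = (s + R) / 2"
  have t: "0 < t" "s < t" "t < R" using assms by (auto simp: t_def)
  \<comment> \<open>The midpoint \<open>t\<close> leaves room for Cauchy's estimates, and a convergence ratio below 1.\<close>
  define q where "q = s / t"
  have q: "0 < q" "q < 1" using t assms by (auto simp: q_def)
  have "(\<lambda>N. K * q ^ N / (1 - q)) \<longlonglongrightarrow> K * 0 / (1 - q)"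
    using q by (intro tendsto_intros LIMSEQ_power_zero) auto
  then have "eventually (\<lambda>N. K * q ^ N / (1 - q) < 1 / 2) sequentially"
    by (rule order_tendstoD) simp
  then obtain N where N: "K * q ^ N / (1 - q) < 1 / 2"
    by (auto simp: eventually_sequentially)
  define c where "c = 1 / (2 * (\<Sum>n<N. s ^ n) + 2)"
  have sum0: "0 \<le> (\<Sum>n<N. s ^ n)" using assms by (intro sum_nonneg) auto
  then have c: "c > 0" "c * (\<Sum>n<N. s ^ n) \<le> 1 / 2"
    unfolding c_def by (auto simp: divide_simps)
  have "\<exists>m\<le>N. c \<le> cmod ((deriv ^^ m) g 0 / fact m)"
    if g: "g holomorphic_on ball 0 R" and K: "\<forall>z\<in>ball 0 R. cmod (g z) \<le> K"
      and z0: "cmod z0 \<le> s" and one: "1 \<le> cmod (g z0)" for g z0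
  proof (rule ccontr)
    define a where "a = (\<lambda>n. (deriv ^^ n) g 0 / fact n)"
    assume "\<not> (\<exists>m\<le>N. c \<le> cmod ((deriv ^^ m) g 0 / fact m))"
    then have small: "cmod (a n) \<le> c" if "n < N" for n
      using that unfolding a_def by (meson less_imp_le not_le)
    have "z0 \<in> ball 0 R" using z0 assms by simp
    from holomorphic_power_series[OF g this]
    have sums: "(\<lambda>n. a n * z0 ^ n) sums g z0" by (simp add: a_def)
    have term_le: "cmod (a n * z0 ^ n) \<le> K * q ^ n" for n
    proof -
      have "cmod (a n) \<le> K / t ^ n"
        unfolding a_def using K t by (intro Cauchy_estimate_ball[OF g]) auto
      moreover have "cmod z0 ^ n \<le> s ^ n" using z0 by (simp add: power_mono)
      ultimately have "cmod (a n) * cmod z0 ^ n \<le> K / t ^ n * s ^ n"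
        by (rule mult_mono) (use t order_trans[OF norm_ge_zero \<open>cmod (a n) \<le> K / t ^ n\<close>] in auto)
      then show ?thesis by (simp add: norm_mult norm_power q_def power_divide)
    qed
    have sg: "summable (\<lambda>n. K * q ^ (n + N))"
      using q by (intro summable_mult summable_ignore_initial_segment summable_geometric) auto
    have "(\<lambda>n. a (n + N) * z0 ^ (n + N)) sums (g z0 - (\<Sum>n<N. a n * z0 ^ n))"
      using sums sums_iff_shift[of "\<lambda>n. a n * z0 ^ n" N] by simp
    then have "cmod (g z0 - (\<Sum>n<N. a n * z0 ^ n)) \<le> (\<Sum>n. K * q ^ (n + N))"
      using norm_suminf_le[OF term_le sg] sums_unique by metis
    also have "\<dots> = K * q ^ N / (1 - q)"
    proof (rule sums_unique[symmetric])
      have "(\<lambda>n. (K * q ^ N) * q ^ n) sums ((K * q ^ N) * (1 / (1 - q)))"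
        using q by (intro sums_mult geometric_sums) auto
      then show "(\<lambda>n. K * q ^ (n + N)) sums (K * q ^ N / (1 - q))"
        by (simp add: power_add mult.assoc mult.commute mult.left_commute)
    qed
    finally have tail: "cmod (g z0 - (\<Sum>n<N. a n * z0 ^ n)) < 1 / 2"
      using N by (rule le_less_trans)
    have "cmod (\<Sum>n<N. a n * z0 ^ n) \<le> (\<Sum>n<N. c * s ^ n)"
    proof (rule sum_norm_le)
      fix n assume "n \<in> {..<N}"
      then show "cmod (a n * z0 ^ n) \<le> c * s ^ n"
        using small[of n] z0 c by (simp add: norm_mult norm_power mult_mono power_mono)
    qed
    also have "\<dots> \<le> 1 / 2" using c by (simp add: sum_distrib_left)
    finally have "cmod (g z0) < 1"
      using tail norm_triangle_sub[of "g z0" "\<Sum>n<N. a n * z0 ^ n"] by linarith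
    then show False using one by simp
  qed
  then show ?thesis using c(1) by blast
qed

text \<open>
  Comparison of Taylor coefficients at 0: if \<open>h = a + (z - t) q\<close>, then
  \<open>h_{m+1} = q_m - t q_{m+1}\<close>.
\<close>
lemma higher_deriv_linear_factor:
  fixes q :: "complex \<Rightarrow> complex"
  assumes q: "q holomorphic_on S" and "open S" "0 \<in> S"
  shows "(deriv ^^ Suc m) (\<lambda>z. a + (z - t) * q z) 0 / fact (Suc m)
           = (deriv ^^ m) q 0 / fact m - t * ((deriv ^^ Suc m) q 0 / fact (Suc m))"
proof -
  have "(deriv ^^ Suc m) (\<lambda>z. (z - t) * q z) w
      = (w - t) * (deriv ^^ Suc m) q w + of_nat (Suc m) * (deriv ^^ m) q w" if "w \<in> S" for w m
    using that
  proof (induction m arbitrary: w)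
    case 0
    have "((\<lambda>z. (z - t) * q z) has_field_derivative (w - t) * deriv q w + q w) (at w)"
      using 0 holomorphic_derivI[OF q \<open>open S\<close>] by (auto intro!: derivative_eq_intros)
    then show ?case by (simp add: DERIV_imp_deriv)
  next
    case (Suc m)
    have D: "((deriv ^^ k) q has_field_derivative (deriv ^^ Suc k) q w) (at w)" for k
      using holomorphic_derivI[OF holomorphic_higher_deriv[OF q \<open>open S\<close>] \<open>open S\<close> Suc.prems] by simp
    have "((\<lambda>w. (w - t) * (deriv ^^ Suc m) q w + of_nat (Suc m) * (deriv ^^ m) q w) has_field_derivative
        (w - t) * (deriv ^^ Suc (Suc m)) q w + of_nat (Suc (Suc m)) * (deriv ^^ Suc m) q w) (at w)"
      using D[of "Suc m"] D[of m]
      by (auto intro!: derivative_eq_intros simp: algebra_simps simp del: funpow.simps)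
    then have "((deriv ^^ Suc m) (\<lambda>z. (z - t) * q z) has_field_derivative
        (w - t) * (deriv ^^ Suc (Suc m)) q w + of_nat (Suc (Suc m)) * (deriv ^^ Suc m) q w) (at w)"
      by (rule DERIV_cong_ev[THEN iffD1, rotated -1, OF _ refl _ refl])
         (use Suc \<open>open S\<close> in \<open>auto simp: eventually_nhds simp del: funpow.simps intro!: exI[of _ S]\<close>)
    then show ?case by (simp add: DERIV_imp_deriv)
  qed
  from this[OF \<open>0 \<in> S\<close>, of m]
  have *: "(deriv ^^ Suc m) (\<lambda>z. (z - t) * q z) 0
      = of_nat (Suc m) * (deriv ^^ m) q 0 - t * (deriv ^^ Suc m) q 0" by simp
  have "(\<lambda>z. (z - t) * q z) holomorphic_on S" by (intro holomorphic_intros q)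
  then have "(deriv ^^ Suc m) (\<lambda>z. a + (z - t) * q z) 0
      = (deriv ^^ Suc m) (\<lambda>z. a) 0 + (deriv ^^ Suc m) (\<lambda>z. (z - t) * q z) 0"
    by (intro higher_deriv_add[OF _ _ \<open>open S\<close> \<open>0 \<in> S\<close>]) auto
  also have "(deriv ^^ Suc m) (\<lambda>z. a) 0 = 0" by (simp add: higher_deriv_const del: funpow.simps)
  finally have **: "(deriv ^^ Suc m) (\<lambda>z. a + (z - t) * q z) 0
      = of_nat (Suc m) * (deriv ^^ m) q 0 - t * (deriv ^^ Suc m) q 0" using * by simp
  have "1 + of_nat m \<noteq> (0::complex)" by (metis of_nat_Suc of_nat_neq_0)
  then show ?thesis unfolding **
    by (simp add: divide_simps del: funpow.simps)
qed

text \<open>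
  A polynomial of degree \<open>m\<close> with leading coefficient bounded below is small only close to its \<open>m\<close>
  roots. The induction imitates this without roots. If \<open>t\<close> is any point of the sublevel set and
  \<open>h = h(t) + (z - t) q\<close>, then at points of the sublevel set at distance at least \<open>\<delta>\<close> from \<open>t\<close> the
  quotient \<open>q\<close> is at most \<open>2 \<epsilon> / \<delta>\<close>; and for small \<open>t\<close> its coefficient of index \<open>m\<close> is nearly
  the coefficient of \<open>h\<close> of index \<open>m + 1\<close>. So one disk around \<open>t\<close> and the \<open>m\<close> disks given for \<open>q\<close>
  suffice.
\<close>
lemma sublevel_set_cover_of_large_coefficient:
  fixes c K :: real
  assumes "c > 0"
  shows "\<exists>\<eta>>0. \<exists>C>0. \<forall>h. h holomorphic_on ball 0 1 \<longrightarrow> (\<forall>z\<in>ball 0 1. cmod (h z) \<le> K) \<longrightarrow>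
           c \<le> cmod ((deriv ^^ m) h 0 / fact m) \<longrightarrow>
           (\<forall>\<epsilon>\<ge>0. \<forall>\<delta>>0. C * \<epsilon> < \<delta> ^ m \<longrightarrow>
             (\<exists>T. finite T \<and> card T \<le> m \<and> {z \<in> ball 0 \<eta>. cmod (h z) \<le> \<epsilon>} \<subseteq> (\<Union>t\<in>T. ball t \<delta>)))"
  using assms
proof (induction m arbitrary: c K)
  case 0
  define B where "B = 4 * \<bar>K\<bar> + 1"
  have B: "B > 0" by (simp add: B_def)
  define \<eta> where "\<eta> = min 1 (c / (2 * B))"
  have "{z \<in> ball 0 \<eta>. cmod (h z) \<le> \<epsilon>} = {}"
    if h: "h holomorphic_on ball 0 1" and K: "\<forall>z\<in>ball 0 1. cmod (h z) \<le> K" and h0: "c \<le> cmod (h 0)"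
      and \<epsilon>: "(2 / c) * \<epsilon> < 1" for h \<epsilon>
  proof -
    have "\<exists>q. q holomorphic_on ball 0 1 \<and> (\<forall>z\<in>ball 0 1. h z = h 0 + (z - 0) * q z) \<and>
           (\<forall>z\<in>ball 0 1. cmod (q z) \<le> 2 * K / (1/2))"
      by (rule difference_quotient_holomorphic_bounded) (use h K in auto)
    then obtain q where q: "\<And>z. z \<in> ball 0 1 \<Longrightarrow> h z = h 0 + (z - 0) * q z"
        "\<And>z. z \<in> ball 0 1 \<Longrightarrow> cmod (q z) \<le> 2 * K / (1/2)"
      by blast
    have "cmod (h z) > \<epsilon>" if z: "z \<in> ball 0 \<eta>" for z
    proof -
      have z1: "z \<in> ball 0 1" "cmod z \<le> c / (2 * B)" using z by (auto simp: \<eta>_def)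
      have "cmod (z * q z) \<le> c / (2 * B) * B"
        unfolding norm_mult using q(2)[OF z1(1)] z1(2) 0 B
        by (intro mult_mono) (auto simp: B_def)
      then have "cmod (h z) \<ge> c / 2"
        using q(1)[OF z1(1)] h0 B norm_triangle_ineq4[of "h 0 + z * q z" "z * q z"] by simp
      moreover have "\<epsilon> < c / 2" using \<epsilon> 0 by (simp add: field_simps)
      ultimately show ?thesis by simp
    qed
    then show ?thesis by fastforce
  qed
  then have "\<exists>T. finite T \<and> card T \<le> 0 \<and> {z \<in> ball 0 \<eta>. cmod (h z) \<le> \<epsilon>} \<subseteq> (\<Union>t\<in>T. ball t \<delta>)"
    if "h holomorphic_on ball 0 1" "\<forall>z\<in>ball 0 1. cmod (h z) \<le> K" "c \<le> cmod (h 0)" "(2 / c) * \<epsilon> < 1"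
    for h \<epsilon> \<delta>
    using that by (intro exI[of _ "{}"]) (simp del: mem_ball)
  moreover have "\<eta> > 0" using 0 B by (simp add: \<eta>_def)
  moreover have "2 / c > 0" using 0 by simp
  ultimately show ?case
    unfolding funpow.simps(1) id_apply fact_0 div_by_1 power_0 by blast
next
  case (Suc m)
  have "c / 2 > 0" using Suc.prems by simp
  from Suc.IH[OF this, of "8 * K"] obtain \<eta>' C' where \<eta>': "\<eta>' > 0" and C': "C' > 0" and
    IH: "\<forall>h. h holomorphic_on ball 0 1 \<longrightarrow> (\<forall>z\<in>ball 0 1. cmod (h z) \<le> 8 * K) \<longrightarrow>
           c / 2 \<le> cmod ((deriv ^^ m) h 0 / fact m) \<longrightarrow>
           (\<forall>\<epsilon>\<ge>0. \<forall>\<delta>>0. C' * \<epsilon> < \<delta> ^ m \<longrightarrow>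
             (\<exists>T. finite T \<and> card T \<le> m \<and> {z \<in> ball 0 \<eta>'. cmod (h z) \<le> \<epsilon>} \<subseteq> (\<Union>t\<in>T. ball t \<delta>)))"
    by (elim exE conjE)
  define B where "B = 8 * \<bar>K\<bar> / (1/2) ^ Suc m + 1"
  have B: "B > 0" by (simp add: B_def add_nonneg_pos)
  define \<eta> where "\<eta> = Min {\<eta>', 1/4, c / (2 * B)}"
  have \<eta>: "\<eta> > 0" "\<eta> \<le> \<eta>'" "\<eta> \<le> 1/4" "\<eta> \<le> c / (2 * B)"
    using \<eta>' Suc.prems B by (auto simp: \<eta>_def)
  have "\<exists>T. finite T \<and> card T \<le> Suc m \<and> {z \<in> ball 0 \<eta>. cmod (h z) \<le> \<epsilon>} \<subseteq> (\<Union>t\<in>T. ball t \<delta>)"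
    if h: "h holomorphic_on ball 0 1" and K: "\<forall>z\<in>ball 0 1. cmod (h z) \<le> K"
      and hm: "c \<le> cmod ((deriv ^^ Suc m) h 0 / fact (Suc m))"
      and \<epsilon>: "\<epsilon> \<ge> 0" and \<delta>: "\<delta> > 0" and small: "2 * C' * \<epsilon> < \<delta> ^ Suc m" for h \<epsilon> \<delta>
  proof (cases "{z \<in> ball 0 \<eta>. cmod (h z) \<le> \<epsilon>} = {}")
    case True
    then show ?thesis by (intro exI[of _ "{}"]) auto
  next
    case False
    then obtain t where t: "cmod t < \<eta>" "cmod (h t) \<le> \<epsilon>" by auto
    have "cball t (1/4) \<subseteq> ball 0 1"
    proof
      fix z assume "z \<in> cball t (1/4)"
      then show "z \<in> ball 0 1"
        using t(1) \<eta>(3) norm_triangle_sub[of z t] by (simp add: dist_norm norm_minus_commute)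
    qed
    then have "\<exists>q. q holomorphic_on ball 0 1 \<and> (\<forall>z\<in>ball 0 1. h z = h t + (z - t) * q z) \<and>
           (\<forall>z\<in>ball 0 1. cmod (q z) \<le> 2 * K / (1/4))"
      by (intro difference_quotient_holomorphic_bounded) (use h K in auto)
    then obtain q where q: "q holomorphic_on ball 0 1"
        "\<And>z. z \<in> ball 0 1 \<Longrightarrow> h z = h t + (z - t) * q z"
        "\<And>z. z \<in> ball 0 1 \<Longrightarrow> cmod (q z) \<le> 2 * K / (1/4)"
      by blast
    have "(deriv ^^ Suc m) h 0 = (deriv ^^ Suc m) (\<lambda>z. h t + (z - t) * q z) 0"
      by (rule higher_deriv_transform_within_open[of _ "ball 0 1"])
         (use h q in \<open>auto intro!: holomorphic_intros simp del: funpow.simps\<close>)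
    then have coeff: "(deriv ^^ Suc m) h 0 / fact (Suc m)
        = (deriv ^^ m) q 0 / fact m - t * ((deriv ^^ Suc m) q 0 / fact (Suc m))"
      using higher_deriv_linear_factor[OF q(1), of m "h t" t] by (simp del: funpow.simps)
    have qB: "cmod ((deriv ^^ Suc m) q 0 / fact (Suc m)) \<le> B"
    proof -
      have "cmod ((deriv ^^ Suc m) q 0 / fact (Suc m)) \<le> 8 * K / (1/2) ^ Suc m"
        by (rule Cauchy_estimate_ball[OF q(1)]) (use q(3) in auto)
      also have "\<dots> \<le> 8 * \<bar>K\<bar> / (1/2) ^ Suc m" by (intro divide_right_mono) auto
      also have "\<dots> \<le> B" by (simp add: B_def)
      finally show ?thesis .
    qed
    have "cmod (t * ((deriv ^^ Suc m) q 0 / fact (Suc m))) \<le> c / (2 * B) * B"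
      unfolding norm_mult using t(1) \<eta>(4) qB Suc.prems B by (intro mult_mono) auto
    then have "cmod (t * ((deriv ^^ Suc m) q 0 / fact (Suc m))) \<le> c / 2" using B by simp
    then have qm: "c / 2 \<le> cmod ((deriv ^^ m) q 0 / fact m)"
      using hm norm_triangle_ineq4[of "(deriv ^^ m) q 0 / fact m" "t * ((deriv ^^ Suc m) q 0 / fact (Suc m))"]
      unfolding coeff by linarith
    have "C' * (2 * \<epsilon> / \<delta>) < \<delta> ^ m" using small \<delta> by (simp add: field_simps)
    moreover have "\<forall>z\<in>ball 0 1. cmod (q z) \<le> 8 * K" using q(3) by simp
    ultimately obtain T where T: "finite T" "card T \<le> m"
        "{z \<in> ball 0 \<eta>'. cmod (q z) \<le> 2 * \<epsilon> / \<delta>} \<subseteq> (\<Union>t\<in>T. ball t \<delta>)"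
      using IH[rule_format, OF q(1) _ qm, of "2 * \<epsilon> / \<delta>" \<delta>] \<epsilon> \<delta> by auto
    have "{z \<in> ball 0 \<eta>. cmod (h z) \<le> \<epsilon>} \<subseteq> (\<Union>s\<in>insert t T. ball s \<delta>)"
    proof
      fix z assume z: "z \<in> {z \<in> ball 0 \<eta>. cmod (h z) \<le> \<epsilon>}"
      show "z \<in> (\<Union>s\<in>insert t T. ball s \<delta>)"
      proof (cases "z \<in> ball t \<delta>")
        case False
        then have far: "\<delta> \<le> cmod (z - t)" by (simp add: dist_norm norm_minus_commute)
        have "(z - t) * q z = h z - h t" using q(2)[of z] z \<eta>(3) by simp
        then have "cmod (z - t) * cmod (q z) \<le> 2 * \<epsilon>"
          using norm_triangle_ineq4[of "h z" "h t"] z t(2) by (simp flip: norm_mult)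
        moreover have "\<delta> * cmod (q z) \<le> cmod (z - t) * cmod (q z)"
          using far by (intro mult_right_mono) auto
        ultimately have "cmod (q z) \<le> 2 * \<epsilon> / \<delta>" using \<delta> by (simp add: field_simps)
        then have "z \<in> {z \<in> ball 0 \<eta>'. cmod (q z) \<le> 2 * \<epsilon> / \<delta>}" using z \<eta>(2) by simp
        then show ?thesis using T(3) by blast
      qed simp
    qed
    moreover have "card (insert t T) \<le> Suc m" using T by (simp add: card_insert_if)
    ultimately show ?thesis using T(1) by (intro exI[of _ "insert t T"]) auto
  qed
  moreover have "2 * C' > 0" using C' by simp
  ultimately show ?case using \<eta>(1) by blast
qed

section \<open>Pointwise values and local averages\<close>

text \<open>
  A weak form of the subharmonicity of \<open>|f|^p\<close>, with a constant that is not sharp. It needs no mean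
  value property: at a maximum \<open>z0\<close> of \<open>|f(z)| (s/2 - |z - a|)^{2/p}\<close> the function is, on a disk of
  radius comparable to the distance \<open>t\<close> to the boundary, bounded by a multiple of \<open>|f(z0)|\<close>, hence
  at least \<open>|f(z0)| / 2\<close> on a smaller disk of comparable radius. That disk alone contributes
  a multiple of \<open>|f(z0)|^p t^2\<close> to the integral, and by maximality this dominates \<open>|f(a)|^p s^2\<close>
  up to a constant.
\<close>
lemma pointwise_bound_by_integral:
  fixes p :: real
  assumes "p > 0"
  shows "\<exists>C>0. \<forall>f a s. s > 0 \<longrightarrow> f holomorphic_on ball a s \<longrightarrow>
           ennreal (cmod (f a) powr p * s\<^sup>2)
             \<le> ennreal C * (\<integral>\<^sup>+z\<in>ball a s. ennreal (cmod (f z) powr p) \<partial>lborel)"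
proof -
  define Q where "Q = (2::real) powr (2 / p)"
  have Q: "Q \<ge> 1" unfolding Q_def using \<open>p > 0\<close> by (intro ge_one_powr_ge_zero) auto
  define c where "c = 1 / (16 * Q)"
  have c: "c > 0" "c < 1 / 2" using Q by (auto simp: c_def field_simps)
  define C where "C = 4 * 2 powr p / (pi * c\<^sup>2)"
  have C: "C > 0" using c by (simp add: C_def)
  have "ennreal (cmod (f a) powr p * s\<^sup>2)
          \<le> ennreal C * (\<integral>\<^sup>+z\<in>ball a s. ennreal (cmod (f z) powr p) \<partial>lborel)"
    if s: "s > 0" and f: "f holomorphic_on ball a s" for f a s
  proof (cases "f a = 0")
    case True
    then show ?thesis by simp
  next
    case False
    define \<phi> where "\<phi> = (\<lambda>z. cmod (f z) * (s / 2 - cmod (z - a)) powr (2 / p))"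
    have fc: "continuous_on (cball a (s / 2)) f"
      by (rule holomorphic_on_imp_continuous_on[OF holomorphic_on_subset[OF f]]) (use s in auto)
    have "continuous_on (cball a (s / 2)) \<phi>"
      unfolding \<phi>_def using \<open>p > 0\<close>
      by (intro continuous_intros continuous_on_powr' fc) (auto simp: dist_norm norm_minus_commute)
    then obtain z0 where z0: "z0 \<in> cball a (s / 2)" and max: "\<And>z. z \<in> cball a (s / 2) \<Longrightarrow> \<phi> z \<le> \<phi> z0"
      using continuous_attains_sup[of "cball a (s / 2)" \<phi>] s by (auto simp del: mem_cball)
    define t where "t = s / 2 - cmod (z0 - a)"
    have "\<phi> a > 0" using False s by (simp add: \<phi>_def)
    moreover have "\<phi> a \<le> \<phi> z0" using s by (intro max) simp
    ultimately have pos: "\<phi> z0 > 0" by simp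
    have t0: "t \<ge> 0" using z0 by (simp add: t_def dist_norm norm_minus_commute)
    have t: "t > 0" and fz0: "f z0 \<noteq> 0" using pos t0 by (auto simp: \<phi>_def t_def less_le)
    have sub: "ball z0 t \<subseteq> cball a (s / 2)"
    proof
      fix z assume "z \<in> ball z0 t"
      then show "z \<in> cball a (s / 2)"
        using norm_triangle_ineq[of "z - z0" "z0 - a"] by (simp add: t_def dist_norm norm_minus_commute)
    qed
    have sub': "ball z0 t \<subseteq> ball a s"
      using sub s by (rule_tac order_trans[of _ "cball a (s / 2)"]) auto
    have comparable: "cmod (f z) \<le> Q * cmod (f z0)" if z: "z \<in> ball z0 (t / 2)" for z
    proof -
      have "z \<in> ball z0 t" using z t by simp
      then have "z \<in> cball a (s / 2)" using sub by blast
      from max[OF this] have "cmod (f z) * (s / 2 - cmod (z - a)) powr (2 / p) \<le> cmod (f z0) * t powr (2 / p)"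
        by (simp add: \<phi>_def t_def)
      moreover have "t / 2 \<le> s / 2 - cmod (z - a)"
        using z norm_triangle_ineq[of "z - z0" "z0 - a"] by (simp add: t_def dist_norm norm_minus_commute)
      then have "cmod (f z) * (t / 2) powr (2 / p) \<le> cmod (f z) * (s / 2 - cmod (z - a)) powr (2 / p)"
        using t \<open>p > 0\<close> by (intro mult_left_mono powr_mono2) auto
      ultimately have "cmod (f z) * (t / 2) powr (2 / p) \<le> cmod (f z0) * t powr (2 / p)" by linarith
      moreover have "(t / 2) powr (2 / p) = t powr (2 / p) / Q" using t by (simp add: powr_divide Q_def)
      ultimately show ?thesis using t Q by (simp add: field_simps)
    qed
    have "\<exists>q. q holomorphic_on ball z0 (t / 2) \<and> (\<forall>z\<in>ball z0 (t / 2). f z = f z0 + (z - z0) * q z) \<and>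
           (\<forall>z\<in>ball z0 (t / 2). cmod (q z) \<le> 2 * (Q * cmod (f z0)) / (t / 4))"
    proof (rule difference_quotient_holomorphic_bounded)
      show "f holomorphic_on ball z0 (t / 2)"
        by (rule holomorphic_on_subset[OF f], rule order_trans[OF subset_ball sub'])
          (use t in auto)
    qed (use comparable t in \<open>auto simp: dist_norm\<close>)
    then obtain q where q: "\<And>z. z \<in> ball z0 (t / 2) \<Longrightarrow> f z = f z0 + (z - z0) * q z"
      "\<And>z. z \<in> ball z0 (t / 2) \<Longrightarrow> cmod (q z) \<le> 2 * (Q * cmod (f z0)) / (t / 4)"
      by blast
    have large: "cmod (f z0) / 2 \<le> cmod (f z)" if z: "z \<in> ball z0 (c * t)" for z
    proof -
      have "c * t < 1 / 2 * t" using c t by (intro mult_strict_right_mono) auto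
      then have z': "z \<in> ball z0 (t / 2)" using z by auto
      have "cmod ((z - z0) * q z) \<le> (c * t) * (2 * (Q * cmod (f z0)) / (t / 4))"
        unfolding norm_mult using z q(2)[OF z'] c t
        by (intro mult_mono) (auto simp: dist_norm norm_minus_commute)
      also have "\<dots> = cmod (f z0) / 2" using t Q by (simp add: c_def)
      finally show ?thesis
        using q(1)[OF z'] norm_triangle_ineq4[of "f z0 + (z - z0) * q z" "(z - z0) * q z"] by simp
    qed
    have "c * t < 1 / 2 * t" using c t by (intro mult_strict_right_mono) auto
    then have ball_sub: "ball z0 (c * t) \<subseteq> ball a s"
      using t by (intro order_trans[OF subset_ball sub']) auto
    have "cmod (f a) powr p * (s / 2)\<^sup>2 = \<phi> a powr p"
      using s \<open>p > 0\<close> False by (simp add: \<phi>_def powr_mult powr_powr powr_numeral)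
    also have "\<dots> \<le> \<phi> z0 powr p"
      using \<open>\<phi> a \<le> \<phi> z0\<close> \<open>\<phi> a > 0\<close> \<open>p > 0\<close> by (intro powr_mono2) auto
    also have "\<dots> = cmod (f z0) powr p * t\<^sup>2"
      using t \<open>p > 0\<close> fz0 by (simp add: \<phi>_def powr_mult powr_powr powr_numeral flip: t_def)
    finally have le: "cmod (f a) powr p * s\<^sup>2 \<le> 4 * (cmod (f z0) powr p * t\<^sup>2)"
      by (simp add: power_divide)
    also have "\<dots> = C * ((cmod (f z0) / 2) powr p * (pi * (c * t)\<^sup>2))"
      using c by (simp add: C_def powr_divide power_mult_distrib)
    finally have "ennreal (cmod (f a) powr p * s\<^sup>2)
        \<le> ennreal (C * ((cmod (f z0) / 2) powr p * (pi * (c * t)\<^sup>2)))"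
      by (rule ennreal_leI)
    also have "\<dots> = ennreal C * (ennreal ((cmod (f z0) / 2) powr p) * emeasure lborel (ball z0 (c * t)))"
      using C c t by (simp add: emeasure_ball unit_ball_vol_2 ennreal_mult)
    also have "ennreal ((cmod (f z0) / 2) powr p) * emeasure lborel (ball z0 (c * t))
        = (\<integral>\<^sup>+z\<in>ball z0 (c * t). ennreal ((cmod (f z0) / 2) powr p) \<partial>lborel)"
      by (subst nn_integral_cmult_indicator) auto
    also have "\<dots> \<le> (\<integral>\<^sup>+z\<in>ball a s. ennreal (cmod (f z) powr p) \<partial>lborel)"
      using large ball_sub \<open>p > 0\<close>
      by (intro nn_integral_mono) (auto simp: indicator_def intro!: ennreal_leI powr_mono2)
    finally show ?thesis by (simp add: mult_left_mono)
  qed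
  then show ?thesis using C by blast
qed

text \<open>
  The factor normalises by the area of the neighbourhood of \<open>w\<close>, which is of order
  \<open>(disk_defect w)^2\<close>.
\<close>
definition local_average :: "real \<Rightarrow> (complex \<Rightarrow> ennreal) \<Rightarrow> complex \<Rightarrow> ennreal" where
  "local_average A u w =
     ennreal (1 / (disk_defect w)\<^sup>2) * (\<integral>\<^sup>+z\<in>{z. near A w z}. u z \<partial>lborel)"

lemma measurable_disk_defect [measurable]: "disk_defect \<in> borel_measurable borel"
  unfolding disk_defect_def by measurable

lemma measurable_indicator_near [measurable]:
  "(\<lambda>(w, z). indicator {z. near A w z} z :: ennreal) \<in> borel_measurable (borel \<Otimes>\<^sub>M borel)"
proof -
  have "{p \<in> space (borel \<Otimes>\<^sub>M borel). near A (fst p) (snd p)} \<in> sets (borel \<Otimes>\<^sub>M borel)"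
    using measurable_near[of A] by (simp add: case_prod_unfold pred_def)
  moreover have "(\<lambda>(w, z). indicator {z. near A w z} z :: ennreal)
      = indicator {p. near A (fst p) (snd p)}"
    by (auto simp: indicator_def)
  ultimately show ?thesis by (simp add: space_pair_measure)
qed

lemma measurable_local_average [measurable]:
  assumes [measurable]: "u \<in> borel_measurable borel"
  shows "local_average A u \<in> borel_measurable borel"
  unfolding local_average_def by measurable

text \<open>
  Tonelli: the total weight with which a point \<open>z\<close> enters the averages is bounded, since the points
  \<open>w\<close> near \<open>z\<close> lie in a disk of radius of order \<open>disk_defect z\<close> and have \<open>disk_defect w\<close> comparable
  to \<open>disk_defect z\<close>.
\<close>
lemma integral_local_average_le:
  fixes A :: real
  assumes "A > 0"
  shows "\<exists>C>0. \<forall>u. u \<in> borel_measurable borel \<longrightarrow>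
           (\<integral>\<^sup>+w. local_average A u w \<partial>lborel) \<le> ennreal C * (\<integral>\<^sup>+z\<in>unit_disk. u z \<partial>lborel)"
proof -
  define C where "C = (1 + 2 * A)\<^sup>2 * (pi * A\<^sup>2)"
  have C: "C > 0" using assms by (simp add: C_def)
  have [measurable]: "unit_disk \<in> sets borel" by simp
  have kernel: "(\<integral>\<^sup>+w. ennreal (1 / (disk_defect w)\<^sup>2) * indicator {z. near A w z} z \<partial>lborel)
      \<le> ennreal C * indicator unit_disk z" for z
  proof (cases "z \<in> unit_disk")
    case False
    then show ?thesis by (simp add: near_def)
  next
    case True
    define d where "d = disk_defect z"
    have d: "d > 0" using disk_defect_pos True by (simp add: d_def)
    have "(\<integral>\<^sup>+w. ennreal (1 / (disk_defect w)\<^sup>2) * indicator {z. near A w z} z \<partial>lborel)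
        \<le> (\<integral>\<^sup>+w\<in>cball z (A * d). ennreal ((1 + 2 * A)\<^sup>2 / d\<^sup>2) \<partial>lborel)"
    proof (rule nn_integral_mono)
      fix w
      show "ennreal (1 / (disk_defect w)\<^sup>2) * indicator {z. near A w z} z
          \<le> ennreal ((1 + 2 * A)\<^sup>2 / d\<^sup>2) * indicator (cball z (A * d)) w"
      proof (cases "near A w z")
        case True
        then have "w \<in> cball z (A * d)" by (simp add: near_def dist_norm norm_minus_commute d_def)
        moreover have "0 < disk_defect w" using True by (auto simp: near_def intro!: disk_defect_pos)
        have "d\<^sup>2 \<le> ((1 + 2 * A) * disk_defect w)\<^sup>2"
          using near_disk_defect_le[OF True] d by (intro power_mono) (auto simp: d_def)
        then have "1 / (disk_defect w)\<^sup>2 \<le> (1 + 2 * A)\<^sup>2 / d\<^sup>2"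
          unfolding power_mult_distrib using d \<open>0 < disk_defect w\<close>
          by (simp add: divide_simps mult.commute)
        ultimately show ?thesis using True by (simp add: ennreal_leI)
      qed simp
    qed
    also have "\<dots> = ennreal ((1 + 2 * A)\<^sup>2 / d\<^sup>2) * emeasure lborel (cball z (A * d))"
      by (subst nn_integral_cmult_indicator) auto
    also have "\<dots> = ennreal ((1 + 2 * A)\<^sup>2 / d\<^sup>2 * (pi * (A * d)\<^sup>2))"
      using assms d by (simp add: emeasure_cball unit_ball_vol_2 flip: ennreal_mult)
    also have "(1 + 2 * A)\<^sup>2 / d\<^sup>2 * (pi * (A * d)\<^sup>2) = C"
      using d by (simp add: C_def power_mult_distrib)
    finally show ?thesis using True by simp
  qed
  have "(\<integral>\<^sup>+w. local_average A u w \<partial>lborel) \<le> ennreal C * (\<integral>\<^sup>+z\<in>unit_disk. u z \<partial>lborel)"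
    if [measurable]: "u \<in> borel_measurable borel" for u
  proof -
    have "(\<integral>\<^sup>+w. local_average A u w \<partial>lborel)
        = (\<integral>\<^sup>+w. (\<integral>\<^sup>+z. ennreal (1 / (disk_defect w)\<^sup>2) * (u z * indicator {z. near A w z} z) \<partial>lborel) \<partial>lborel)"
      unfolding local_average_def by (intro nn_integral_cong nn_integral_cmult[symmetric]) measurable
    also have "\<dots> = (\<integral>\<^sup>+z. (\<integral>\<^sup>+w. ennreal (1 / (disk_defect w)\<^sup>2) * (u z * indicator {z. near A w z} z) \<partial>lborel) \<partial>lborel)"
      by (rule lborel_pair.Fubini'[symmetric]) measurable
    also have "\<dots> = (\<integral>\<^sup>+z. u z * (\<integral>\<^sup>+w. ennreal (1 / (disk_defect w)\<^sup>2) * indicator {z. near A w z} z \<partial>lborel) \<partial>lborel)"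
      by (intro nn_integral_cong, subst nn_integral_cmult[symmetric]) (auto simp: ac_simps)
    also have "\<dots> \<le> (\<integral>\<^sup>+z. u z * (ennreal C * indicator unit_disk z) \<partial>lborel)"
      by (intro nn_integral_mono mult_left_mono kernel) auto
    also have "\<dots> = ennreal C * (\<integral>\<^sup>+z\<in>unit_disk. u z \<partial>lborel)"
    proof -
      have "(\<lambda>z. u z * indicator unit_disk z) \<in> borel_measurable lborel" by measurable
      then show ?thesis by (subst nn_integral_cmult[symmetric]) (simp_all add: ac_simps)
    qed
    finally show ?thesis .
  qed
  then show ?thesis using C by blast
qed

section \<open>The estimate near a single point\<close>

text \<open>
  Every point \<open>z\<close> near \<open>w\<close> is the centre of a disk of radius \<open>disk_defect z / 4\<close> whose points are
  still near \<open>w\<close>, with the larger constant \<open>2 B + 1/2\<close> that transitivity produces from \<open>B\<close> and 1/2.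
\<close>
lemma sup_bound_of_local_integral:
  fixes p B K :: real
  assumes "p > 0" "B \<ge> 0" "K > 0"
  shows "\<exists>K'>0. \<forall>w f M. f holomorphic_on unit_disk \<longrightarrow> M \<ge> 0 \<longrightarrow>
           (\<integral>\<^sup>+z\<in>{z. near (2 * B + 1 / 2) w z}. ennreal (cmod (f z) powr p) \<partial>lborel)
             \<le> ennreal (K * (M powr p * (disk_defect w)\<^sup>2)) \<longrightarrow>
           (\<forall>z. near B w z \<longrightarrow> cmod (f z) \<le> K' * M)"
proof -
  obtain C where "C > 0" and C: "\<And>f a s. s > 0 \<Longrightarrow> f holomorphic_on ball a s \<Longrightarrow>
      ennreal (cmod (f a) powr p * s\<^sup>2) \<le> ennreal C * (\<integral>\<^sup>+z\<in>ball a s. ennreal (cmod (f z) powr p) \<partial>lborel)"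
    using pointwise_bound_by_integral[OF \<open>p > 0\<close>] by blast
  define Y where "Y = 16 * C * K * (1 + 2 * B)\<^sup>2"
  have Y: "Y > 0" using \<open>C > 0\<close> assms by (simp add: Y_def)
  have "cmod (f z) \<le> Y powr (1 / p) * M"
    if f: "f holomorphic_on unit_disk" and M: "M \<ge> 0"
      and int: "(\<integral>\<^sup>+z\<in>{z. near (2 * B + 1 / 2) w z}. ennreal (cmod (f z) powr p) \<partial>lborel)
             \<le> ennreal (K * (M powr p * (disk_defect w)\<^sup>2))"
      and z: "near B w z" for w f M z
  proof -
    have zD: "z \<in> unit_disk" and wD: "w \<in> unit_disk" using z by (auto simp: near_def)
    define s where "s = disk_defect z / 4"
    have s: "s > 0" using disk_defect_pos[OF zD] by (simp add: s_def)
    have sub: "near (2 * B + 1 / 2) w x" if "x \<in> ball z s" for x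
    proof -
      have "near (1 / 2) z x"
        using that near_ball[OF zD, of x] by (simp add: s_def dist_norm norm_minus_commute)
      from near_trans[OF z this] show ?thesis using \<open>B \<ge> 0\<close> by simp
    qed
    have "ball z s \<subseteq> unit_disk" using sub by (auto simp: near_def)
    then have "ennreal (cmod (f z) powr p * s\<^sup>2)
        \<le> ennreal C * (\<integral>\<^sup>+x\<in>ball z s. ennreal (cmod (f x) powr p) \<partial>lborel)"
      using f s by (intro C) (auto intro: holomorphic_on_subset)
    also have "\<dots> \<le> ennreal C * (\<integral>\<^sup>+x\<in>{x. near (2 * B + 1 / 2) w x}. ennreal (cmod (f x) powr p) \<partial>lborel)"
      using sub by (intro mult_left_mono nn_integral_mono) (auto simp: indicator_def)
    also have "\<dots> \<le> ennreal C * ennreal (K * (M powr p * (disk_defect w)\<^sup>2))"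
      using int by (intro mult_left_mono) auto
    also have "\<dots> = ennreal (C * (K * (M powr p * (disk_defect w)\<^sup>2)))"
      using \<open>C > 0\<close> assms by (simp add: ennreal_mult)
    finally have "cmod (f z) powr p * s\<^sup>2 \<le> C * (K * (M powr p * (disk_defect w)\<^sup>2))"
      using \<open>C > 0\<close> assms by (subst (asm) ennreal_le_iff) auto
    also have "(disk_defect w)\<^sup>2 \<le> ((1 + 2 * B) * (4 * s))\<^sup>2"
      using near_disk_defect_le[of B z w] z disk_defect_pos[OF wD]
      by (intro power_mono) (auto simp: near_sym s_def)
    then have "C * (K * (M powr p * (disk_defect w)\<^sup>2)) \<le> C * (K * (M powr p * ((1 + 2 * B) * (4 * s))\<^sup>2))"
      using \<open>C > 0\<close> assms by (intro mult_left_mono) auto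
    also have "\<dots> = Y * M powr p * s\<^sup>2" by (simp add: Y_def power_mult_distrib)
    finally have "cmod (f z) powr p \<le> Y * M powr p" using s by simp
    then have "(cmod (f z) powr p) powr (1 / p) \<le> (Y * M powr p) powr (1 / p)"
      using \<open>p > 0\<close> by (intro powr_mono2) auto
    then show ?thesis using \<open>p > 0\<close> Y M by (simp add: powr_powr powr_mult)
  qed
  moreover have "Y powr (1 / p) > 0" using Y by simp
  ultimately show ?thesis by blast
qed

text \<open>
  The index of the large Taylor coefficient depends on \<open>h\<close>, but it is bounded by some \<open>N\<close>; the
  covering constants of the finitely many indices are merged here.
\<close>
lemma sublevel_set_cover_unit_disk:
  fixes K :: real
  shows "\<exists>\<eta>>0. \<exists>N. \<exists>c>0. \<eta> \<le> 1 \<and> (\<forall>h z0 \<delta>. h holomorphic_on ball 0 1 \<longrightarrow>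
           (\<forall>z\<in>ball 0 1. cmod (h z) \<le> K) \<longrightarrow> cmod z0 \<le> 1/2 \<longrightarrow> 1 \<le> cmod (h z0) \<longrightarrow>
           0 < \<delta> \<longrightarrow> \<delta> < 1 \<longrightarrow>
           (\<exists>T. finite T \<and> card T \<le> N \<and> {z \<in> ball 0 \<eta>. cmod (h z) \<le> c * \<delta> ^ N} \<subseteq> (\<Union>t\<in>T. ball t \<delta>)))"
proof -
  have "0 < (1/2 :: real)" "1/2 < (1 :: real)" by simp_all
  from large_Taylor_coefficient[OF this, of K] obtain N b where "b > 0" and
    Nb: "\<forall>g z0. g holomorphic_on ball 0 1 \<longrightarrow> (\<forall>z\<in>ball 0 1. cmod (g z) \<le> K) \<longrightarrow>
           cmod z0 \<le> 1/2 \<longrightarrow> 1 \<le> cmod (g z0) \<longrightarrow> (\<exists>m\<le>N. b \<le> cmod ((deriv ^^ m) g 0 / fact m))"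
    by (elim exE conjE)
  define P where "P = (\<lambda>m \<eta> C. \<forall>h. h holomorphic_on ball 0 1 \<longrightarrow> (\<forall>z\<in>ball 0 1. cmod (h z) \<le> K) \<longrightarrow>
           b \<le> cmod ((deriv ^^ m) h 0 / fact m) \<longrightarrow>
           (\<forall>\<epsilon>\<ge>0. \<forall>\<delta>>0. C * \<epsilon> < \<delta> ^ m \<longrightarrow>
             (\<exists>T. finite T \<and> card T \<le> m \<and> {z \<in> ball 0 \<eta>. cmod (h z) \<le> \<epsilon>} \<subseteq> (\<Union>t\<in>T. ball t \<delta>))))"
  have "\<exists>\<eta>>0. \<exists>C>0. P m \<eta> C" for m
    unfolding P_def by (rule sublevel_set_cover_of_large_coefficient) fact
  then obtain \<eta> C where \<eta>: "\<And>m. \<eta> m > (0::real)" and C: "\<And>m. C m > (0::real)" and P: "\<And>m. P m (\<eta> m) (C m)"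
    by metis
  define H where "H = Min (insert 1 (\<eta> ` {..N}))"
  have H: "H > 0" "H \<le> 1" "\<And>m. m \<le> N \<Longrightarrow> H \<le> \<eta> m"
    using \<eta> by (simp_all add: H_def min.coboundedI2)
  define D where "D = Max (C ` {..N})"
  have DC: "C m \<le> D" if "m \<le> N" for m using that by (simp add: D_def)
  then have D: "D > 0" using C[of 0] by (meson less_le_trans zero_le)
  define c where "c = 1 / (2 * D)"
  have c: "c > 0" using D by (simp add: c_def)
  have "\<exists>T. finite T \<and> card T \<le> N \<and> {z \<in> ball 0 H. cmod (h z) \<le> c * \<delta> ^ N} \<subseteq> (\<Union>t\<in>T. ball t \<delta>)"
    if h: "h holomorphic_on ball 0 1" and K: "\<forall>z\<in>ball 0 1. cmod (h z) \<le> K"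
      and z0: "cmod z0 \<le> 1/2" "1 \<le> cmod (h z0)" and \<delta>: "0 < \<delta>" "\<delta> < 1" for h z0 \<delta>
  proof -
    obtain m where m: "m \<le> N" and hm: "b \<le> cmod ((deriv ^^ m) h 0 / fact m)"
      using Nb h K z0 by blast
    have "C m * (c * \<delta> ^ N) \<le> D * (c * \<delta> ^ N)"
      using DC[OF m] c \<delta> by (intro mult_right_mono) auto
    also have "\<dots> = \<delta> ^ N / 2" using D by (simp add: c_def)
    also have "\<dots> < \<delta> ^ N" using \<delta> by simp
    also have "\<dots> \<le> \<delta> ^ m" using \<delta> m by (intro power_decreasing) auto
    finally have lt: "C m * (c * \<delta> ^ N) < \<delta> ^ m" .
    have "c * \<delta> ^ N \<ge> 0" using c \<delta> by simp
    then obtain T where "finite T" "card T \<le> m"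
        "{z \<in> ball 0 (\<eta> m). cmod (h z) \<le> c * \<delta> ^ N} \<subseteq> (\<Union>t\<in>T. ball t \<delta>)"
      using P[of m, unfolded P_def, rule_format, OF h _ hm _ \<delta>(1) lt] K by blast
    moreover have "{z \<in> ball 0 H. cmod (h z) \<le> c * \<delta> ^ N} \<subseteq> {z \<in> ball 0 (\<eta> m). cmod (h z) \<le> c * \<delta> ^ N}"
      using H(3)[OF m] by auto
    ultimately have "finite T \<and> card T \<le> N \<and> {z \<in> ball 0 H. cmod (h z) \<le> c * \<delta> ^ N} \<subseteq> (\<Union>t\<in>T. ball t \<delta>)"
      using m by (meson order_trans)
    then show ?thesis by blast
  qed
  then show ?thesis using H(1,2) c by blast
qed

text \<open>
  If \<open>f\<close> is tiny on a small disk around \<open>a\<close>, Cauchy's estimates in the Moebius coordinate centred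
  at \<open>a\<close> make its first Taylor coefficients tiny. A function bounded on the larger disk of radius
  \<open>(1 + r) / 2\<close> would then be small on the whole disk of radius \<open>r\<close>, which in this coordinate
  contains \<open>w\<close>.
\<close>
lemma propagation_of_smallness:
  fixes r K :: real
  assumes "0 < r" "r < 1"
  shows "\<exists>\<sigma>>0. \<forall>a w f M. a \<in> unit_disk \<longrightarrow> w \<in> unit_disk \<longrightarrow> pseudohyperbolic_dist a w \<le> r \<longrightarrow>
           f holomorphic_on unit_disk \<longrightarrow> M > 0 \<longrightarrow> M \<le> cmod (f w) \<longrightarrow>
           (\<forall>z. near ((1 + r) / (1 - r)) a z \<longrightarrow> cmod (f z) \<le> K * M) \<longrightarrow>
           (\<exists>z. cmod (z - a) \<le> disk_defect a / 8 \<and> \<sigma> * M \<le> cmod (f z))"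
proof -
  \<comment> \<open>A radius strictly between \<open>r\<close> and 1, whose neighbourhoods have the constant \<open>(1 + r) / (1 - r)\<close>.\<close>
  define R where "R = (1 + r) / 2"
  have R: "r < R" "1/2 < R" "R < 1" using assms by (auto simp: R_def)
  have RA: "R / (1 - R) = (1 + r) / (1 - r)" using assms by (simp add: R_def field_simps)
  from large_Taylor_coefficient[OF assms(1) R(1), of K] obtain N b where "b > 0" and
    Nb: "\<forall>g z0. g holomorphic_on ball 0 R \<longrightarrow> (\<forall>z\<in>ball 0 R. cmod (g z) \<le> K) \<longrightarrow>
           cmod z0 \<le> r \<longrightarrow> 1 \<le> cmod (g z0) \<longrightarrow> (\<exists>m\<le>N. b \<le> cmod ((deriv ^^ m) g 0 / fact m))"
    by (elim exE conjE)
  define \<sigma> where "\<sigma> = b / (2 * 20 ^ N)"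
  have \<sigma>: "\<sigma> > 0" using \<open>b > 0\<close> by (simp add: \<sigma>_def)
  have "\<exists>z. cmod (z - a) \<le> disk_defect a / 8 \<and> \<sigma> * M \<le> cmod (f z)"
    if a: "a \<in> unit_disk" and w: "w \<in> unit_disk" and aw: "pseudohyperbolic_dist a w \<le> r"
      and f: "f holomorphic_on unit_disk" and M: "M > 0" "M \<le> cmod (f w)"
      and K: "\<And>z. near ((1 + r) / (1 - r)) a z \<Longrightarrow> cmod (f z) \<le> K * M" for a w f M
  proof (rule ccontr)
    assume "\<not> ?thesis"
    then have small: "cmod (f z) < \<sigma> * M" if "cmod (z - a) \<le> disk_defect a / 8" for z
      using that by force
    define g where "g = (\<lambda>u. f (disk_involution a u) / M)"
    have hol: "g holomorphic_on unit_disk"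
    proof -
      have "(f \<circ> disk_involution a) holomorphic_on unit_disk"
        using disk_involution_in_disk[OF a]
        by (intro holomorphic_on_compose_gen[OF disk_involution_holomorphic[OF a] f]) auto
      then show ?thesis using M unfolding g_def comp_def by (intro holomorphic_intros) auto
    qed
    have "g holomorphic_on ball 0 R" by (rule holomorphic_on_subset[OF hol]) (use R in auto)
    moreover have "\<forall>u\<in>ball 0 R. cmod (g u) \<le> K"
    proof
      fix u :: complex assume u: "u \<in> ball 0 R"
      have "near ((1 + r) / (1 - r)) a (disk_involution a u)"
        unfolding RA[symmetric] by (rule near_disk_involution[OF a]) (use u R in auto)
      from K[OF this] show "cmod (g u) \<le> K" using M by (simp add: g_def norm_divide field_simps)
    qed
    moreover have "cmod (disk_involution a w) \<le> r" using aw by (simp add: cmod_disk_involution)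
    moreover have "1 \<le> cmod (g (disk_involution a w))"
      using M disk_involution_involutive[OF a w] by (simp add: g_def norm_divide)
    ultimately obtain m where m: "m \<le> N" "b \<le> cmod ((deriv ^^ m) g 0 / fact m)"
      using Nb by blast
    \<comment> \<open>The involution sends the disk of radius 1/10 into the disk of radius \<open>disk_defect a / 9\<close> around \<open>a\<close>.\<close>
    have "cmod ((deriv ^^ m) g 0 / fact m) \<le> \<sigma> / (1/20) ^ m"
    proof (rule Cauchy_estimate_ball[of g "1/10"])
      show "g holomorphic_on ball 0 (1/10)" by (rule holomorphic_on_subset[OF hol]) auto
      fix u :: complex assume u: "u \<in> ball 0 (1/10)"
      have "near ((1/10) / (1 - 1/10)) a (disk_involution a u)"
        by (rule near_disk_involution[OF a]) (use u in auto)
      then have "cmod (disk_involution a u - a) \<le> disk_defect a / 9"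
        by (simp add: near_def norm_minus_commute)
      then have "cmod (disk_involution a u - a) \<le> disk_defect a / 8"
        using disk_defect_pos[OF a] by linarith
      from small[OF this] show "cmod (g u) \<le> \<sigma>" using M by (simp add: g_def norm_divide field_simps)
    qed auto
    also have "\<dots> = \<sigma> * 20 ^ m" by (simp add: power_divide)
    also have "\<dots> \<le> \<sigma> * 20 ^ N" using m \<sigma> by (intro mult_left_mono power_increasing) auto
    also have "\<dots> < b" using \<open>b > 0\<close> by (simp add: \<sigma>_def)
    finally show False using m by simp
  qed
  then show ?thesis using \<sigma> by blast
qed

text \<open>
  The covering of sublevel sets transferred to a small Euclidean disk around \<open>a\<close>, which is mapped
  affinely to the unit disk. The point at which the rescaled function is not small is provided by
  the preceding lemma; it lies within half of the radius.
\<close>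
lemma sublevel_set_cover_disk_point:
  fixes r K :: real
  assumes "0 < r" "r < 1"
  shows "\<exists>\<eta>>0. \<exists>N. \<exists>c>0. \<eta> \<le> 1 \<and> (\<forall>a w f M \<delta>. a \<in> unit_disk \<longrightarrow> w \<in> unit_disk \<longrightarrow>
           pseudohyperbolic_dist a w \<le> r \<longrightarrow> f holomorphic_on unit_disk \<longrightarrow> M > 0 \<longrightarrow> M \<le> cmod (f w) \<longrightarrow>
           (\<forall>z. near ((1 + r) / (1 - r)) a z \<longrightarrow> cmod (f z) \<le> K * M) \<longrightarrow> 0 < \<delta> \<longrightarrow> \<delta> < 1 \<longrightarrow>
           (\<exists>T. finite T \<and> card T \<le> N \<and>
              {z \<in> ball a (\<eta> * (disk_defect a / 4)). cmod (f z) \<le> c * \<delta> ^ N * M}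
                \<subseteq> (\<Union>t\<in>T. ball t (\<delta> * (disk_defect a / 4)))))"
proof -
  obtain \<sigma> where "\<sigma> > 0" and \<sigma>: "\<forall>a w f M. a \<in> unit_disk \<longrightarrow> w \<in> unit_disk \<longrightarrow> pseudohyperbolic_dist a w \<le> r \<longrightarrow>
           f holomorphic_on unit_disk \<longrightarrow> M > 0 \<longrightarrow> M \<le> cmod (f w) \<longrightarrow>
           (\<forall>z. near ((1 + r) / (1 - r)) a z \<longrightarrow> cmod (f z) \<le> K * M) \<longrightarrow>
           (\<exists>z. cmod (z - a) \<le> disk_defect a / 8 \<and> \<sigma> * M \<le> cmod (f z))"
    using propagation_of_smallness[OF assms, of K] by (elim exE conjE)
  obtain \<eta> N c where \<eta>: "\<eta> > 0" "\<eta> \<le> 1" and c: "c > 0" and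
    cover: "\<forall>h z0 \<delta>. h holomorphic_on ball 0 1 \<longrightarrow>
           (\<forall>z\<in>ball 0 1. cmod (h z) \<le> K / \<sigma>) \<longrightarrow> cmod z0 \<le> 1/2 \<longrightarrow> 1 \<le> cmod (h z0) \<longrightarrow>
           0 < \<delta> \<longrightarrow> \<delta> < 1 \<longrightarrow>
           (\<exists>T. finite T \<and> card T \<le> N \<and> {z \<in> ball 0 \<eta>. cmod (h z) \<le> c * \<delta> ^ N} \<subseteq> (\<Union>t\<in>T. ball t \<delta>))"
    using sublevel_set_cover_unit_disk[of "K / \<sigma>"] by (elim exE conjE)
  have "\<exists>T. finite T \<and> card T \<le> N \<and>
              {z \<in> ball a (\<eta> * (disk_defect a / 4)). cmod (f z) \<le> c * \<sigma> * \<delta> ^ N * M}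
                \<subseteq> (\<Union>t\<in>T. ball t (\<delta> * (disk_defect a / 4)))"
    if a: "a \<in> unit_disk" and w: "w \<in> unit_disk" and aw: "pseudohyperbolic_dist a w \<le> r"
      and f: "f holomorphic_on unit_disk" and M: "M > 0" "M \<le> cmod (f w)"
      and K: "\<forall>z. near ((1 + r) / (1 - r)) a z \<longrightarrow> cmod (f z) \<le> K * M"
      and \<delta>: "0 < \<delta>" "\<delta> < 1" for a w f M \<delta>
  proof -
    define s where "s = disk_defect a / 4"
    have s: "s > 0" using disk_defect_pos[OF a] by (simp add: s_def)
    define h where "h = (\<lambda>v. f (a + of_real s * v) / (\<sigma> * M))"
    have dist: "cmod (a + of_real s * v - a) = s * cmod v" for v using s by (simp add: norm_mult)
    have nr: "near (1/2) a (a + of_real s * v)" if "v \<in> ball 0 1" for v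
      using s that by (intro near_ball[OF a]) (simp add: norm_mult flip: s_def)
    have "(f \<circ> (\<lambda>v. a + of_real s * v)) holomorphic_on ball 0 1"
      using nr by (intro holomorphic_on_compose_gen[OF _ f] holomorphic_intros) (auto simp: near_def)
    then have hol: "h holomorphic_on ball 0 1"
      unfolding h_def comp_def using M \<open>\<sigma> > 0\<close> by (intro holomorphic_intros) auto
    have bounded: "\<forall>v\<in>ball 0 1. cmod (h v) \<le> K / \<sigma>"
    proof
      fix v :: complex assume "v \<in> ball 0 1"
      then have "near ((1 + r) / (1 - r)) a (a + of_real s * v)"
        using assms by (intro near_mono[OF nr]) (auto simp: field_simps)
      then have "cmod (f (a + of_real s * v)) \<le> K * M" using K by blast
      then show "cmod (h v) \<le> K / \<sigma>"
        using M \<open>\<sigma> > 0\<close> by (simp add: h_def norm_divide norm_mult field_simps)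
    qed
    obtain z0 where z0: "cmod (z0 - a) \<le> disk_defect a / 8" "\<sigma> * M \<le> cmod (f z0)"
      using \<sigma> a w aw f M K by blast
    have half: "cmod ((z0 - a) / of_real s) \<le> 1 / 2"
    proof -
      have "cmod ((z0 - a) / of_real s) = cmod (z0 - a) / s" using s by (simp add: norm_divide)
      also have "\<dots> \<le> 1 / 2" using z0(1) s unfolding s_def by (simp add: divide_le_eq)
      finally show ?thesis .
    qed
    have one: "1 \<le> cmod (h ((z0 - a) / of_real s))"
      using z0(2) s M \<open>\<sigma> > 0\<close> by (simp add: h_def norm_divide norm_mult)
    obtain T where T: "finite T" "card T \<le> N"
        "{z \<in> ball 0 \<eta>. cmod (h z) \<le> c * \<delta> ^ N} \<subseteq> (\<Union>t\<in>T. ball t \<delta>)"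
      using cover[rule_format, OF hol _ half one \<delta>] bounded by blast
    have "{z \<in> ball a (\<eta> * s). cmod (f z) \<le> c * \<sigma> * \<delta> ^ N * M}
        \<subseteq> (\<Union>t\<in>(\<lambda>t. a + of_real s * t) ` T. ball t (\<delta> * s))"
    proof
      fix z assume z: "z \<in> {z \<in> ball a (\<eta> * s). cmod (f z) \<le> c * \<sigma> * \<delta> ^ N * M}"
      define v where "v = (z - a) / of_real s"
      have zv: "z = a + of_real s * v" using s by (simp add: v_def)
      have "s * cmod v < \<eta> * s" using z dist[of v] zv by (simp add: dist_norm norm_minus_commute)
      then have "v \<in> ball 0 \<eta>" using s by simp
      moreover have "cmod (h v) \<le> c * \<delta> ^ N"
      proof -
        have "cmod (h v) = cmod (f z) / (\<sigma> * M)"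
          using M \<open>\<sigma> > 0\<close> by (simp add: h_def norm_divide norm_mult flip: zv)
        then show ?thesis using z M \<open>\<sigma> > 0\<close> by (simp add: divide_le_eq mult_ac)
      qed
      ultimately obtain t where t: "t \<in> T" "cmod (t - v) < \<delta>"
        using T(3) by (auto simp: dist_norm)
      have "cmod ((a + of_real s * t) - z) = s * cmod (t - v)"
        using s by (simp add: zv norm_mult flip: right_diff_distrib)
      also have "\<dots> < \<delta> * s" using t s by simp
      finally show "z \<in> (\<Union>t\<in>(\<lambda>t. a + of_real s * t) ` T. ball t (\<delta> * s))"
        using t by (auto simp: dist_norm)
    qed
    moreover have "card ((\<lambda>t. a + of_real s * t) ` T) \<le> N"
      using card_image_le[OF T(1)] T(2) order_trans by blast
    ultimately show ?thesis unfolding s_def using T(1) by blast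
  qed
  moreover have "c * \<sigma> > 0" using c \<open>\<sigma> > 0\<close> by simp
  ultimately show ?thesis using \<eta> by blast
qed

lemma pseudohyperbolic_disk_borel: "pseudohyperbolic_disk w r \<in> sets borel"
proof -
  have "{z \<in> space borel. z \<in> unit_disk \<and> pseudohyperbolic_dist w z < r} \<in> sets borel"
    unfolding pseudohyperbolic_dist_def mem_ball dist_norm by measurable
  then show ?thesis by (simp add: pseudohyperbolic_disk_def)
qed

lemma pseudohyperbolic_disk_lmeasurable: "pseudohyperbolic_disk w r \<in> lmeasurable"
proof (rule bounded_set_imp_lmeasurable)
  show "bounded (pseudohyperbolic_disk w r)"
    by (rule bounded_subset[of unit_disk]) (auto simp: pseudohyperbolic_disk_def)
  show "pseudohyperbolic_disk w r \<in> sets lebesgue"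
    using pseudohyperbolic_disk_borel by (metis sets_completionI_sets sets_lborel)
qed

lemma measure_pseudohyperbolic_disk_ge:
  assumes "w \<in> unit_disk" "0 < r" "r < 1"
  shows "pi * (r / 4 * disk_defect w)\<^sup>2 \<le> measure lebesgue (pseudohyperbolic_disk w r)"
proof -
  have "measure lebesgue (ball w (r / 4 * disk_defect w)) \<le> measure lebesgue (pseudohyperbolic_disk w r)"
    using ball_subset_pseudohyperbolic_disk[OF assms] pseudohyperbolic_disk_lmeasurable
    by (intro measure_mono_fmeasurable) auto
  then show ?thesis
    using assms disk_defect_pos[OF assms(1)] by (simp add: content_ball unit_ball_vol_2)
qed

text \<open>
  Pigeonhole: the disk of pseudohyperbolic radius \<open>r\<close> around \<open>w\<close> is covered by a number of
  Euclidean disks of radius \<open>\<kappa> * disk_defect w / 2\<close> that does not depend on \<open>w\<close>, so one of them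
  carries a fixed proportion of \<open>E\<close>. Recentring it at one of its points in the pseudohyperbolic
  disk at most doubles its radius.
\<close>
lemma concentration_in_small_ball:
  fixes r \<kappa> :: real
  assumes r: "0 < r" "r < 1" and \<kappa>: "\<kappa> > 0"
  shows "\<exists>c>0. \<forall>w E \<gamma>. w \<in> unit_disk \<longrightarrow> E \<in> sets lebesgue \<longrightarrow> \<gamma> > 0 \<longrightarrow>
           \<gamma> * measure lebesgue (pseudohyperbolic_disk w r) \<le> measure lebesgue (E \<inter> pseudohyperbolic_disk w r) \<longrightarrow>
           (\<exists>a\<in>pseudohyperbolic_disk w r.
              c * \<gamma> * (disk_defect w)\<^sup>2 \<le> measure lebesgue (E \<inter> ball a (\<kappa> * disk_defect w)))"
proof -
  define A where "A = r / (1 - r)"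
  have "compact (cball (0::complex) A)" by simp
  then obtain k where k: "finite k" "cball (0::complex) A \<subseteq> (\<Union>x\<in>k. ball x (\<kappa> / 2))"
    unfolding compact_eq_totally_bounded using \<kappa> half_gt_zero by blast
  define c where "c = pi * (r / 4)\<^sup>2 / (card k + 1)"
  have c: "c > 0" using r by (simp add: c_def)
  have main: "\<exists>a\<in>pseudohyperbolic_disk w r.
              c * \<gamma> * (disk_defect w)\<^sup>2 \<le> measure lebesgue (E \<inter> ball a (\<kappa> * disk_defect w))"
    if w: "w \<in> unit_disk" and E: "E \<in> sets lebesgue" and \<gamma>: "\<gamma> > 0"
      and dense: "\<gamma> * measure lebesgue (pseudohyperbolic_disk w r)
                    \<le> measure lebesgue (E \<inter> pseudohyperbolic_disk w r)" for w E \<gamma>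
  proof (rule ccontr)
    define P where "P = pseudohyperbolic_disk w r"
    define d where "d = disk_defect w"
    have d: "d > 0" using disk_defect_pos[OF w] by (simp add: d_def)
    have PM: "P \<in> lmeasurable" unfolding P_def by (rule pseudohyperbolic_disk_lmeasurable)
    assume "\<not> ?thesis"
    then have small: "measure lebesgue (E \<inter> ball a (\<kappa> * d)) < c * \<gamma> * d\<^sup>2" if "a \<in> P" for a
      using that by (auto simp: P_def d_def not_le)
    define F where "F = (\<lambda>x. E \<inter> P \<inter> ball (w + of_real d * x) (\<kappa> / 2 * d))"
    have FM: "F x \<in> lmeasurable" for x
    proof -
      have "F x = P \<inter> (E \<inter> ball (w + of_real d * x) (\<kappa> / 2 * d))" by (auto simp: F_def)
      then show ?thesis using E PM by (auto intro!: fmeasurable_Int_fmeasurable sets.Int)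
    qed
    have Fsmall: "measure lebesgue (F x) \<le> c * \<gamma> * d\<^sup>2" for x
    proof (cases "F x = {}")
      case True
      then show ?thesis using c \<gamma> by simp
    next
      case False
      then obtain a where a: "a \<in> P" "a \<in> ball (w + of_real d * x) (\<kappa> / 2 * d)"
        by (auto simp: F_def)
      have "F x \<subseteq> E \<inter> ball a (\<kappa> * d)"
      proof
        fix z assume z: "z \<in> F x"
        have "dist a z \<le> dist a (w + of_real d * x) + dist (w + of_real d * x) z"
          by (rule dist_triangle)
        also have "\<dots> < \<kappa> / 2 * d + \<kappa> / 2 * d"
          using a z by (intro add_strict_mono) (auto simp: F_def dist_commute)
        finally show "z \<in> E \<inter> ball a (\<kappa> * d)" using z by (simp add: F_def)
      qed
      then have "measure lebesgue (F x) \<le> measure lebesgue (E \<inter> ball a (\<kappa> * d))"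
        using FM fmeasurable_Int_fmeasurable[OF lmeasurable_ball E, of a "\<kappa> * d"]
        by (intro measure_mono_fmeasurable) (auto simp: Int_commute)
      then show ?thesis using small[OF a(1)] by linarith
    qed
    have "E \<inter> P \<subseteq> (\<Union>x\<in>k. F x)"
    proof
      fix z assume z: "z \<in> E \<inter> P"
      then have "near A w z"
        unfolding A_def P_def using w r
        by (intro near_if_pseudohyperbolic_dist_le) (auto simp: pseudohyperbolic_disk_def)
      then have "cmod ((z - w) / of_real d) \<le> A"
        using d by (simp add: near_def norm_divide d_def norm_minus_commute field_simps)
      then have "(z - w) / of_real d \<in> cball 0 A" by simp
      then have "(z - w) / of_real d \<in> (\<Union>x\<in>k. ball x (\<kappa> / 2))" using k(2) by blast
      then obtain x where x: "x \<in> k" "cmod (x - (z - w) / of_real d) < \<kappa> / 2"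
        unfolding UN_iff mem_ball dist_norm by blast
      have "w + of_real d * x - z = of_real d * (x - (z - w) / of_real d)"
        using d by (simp add: field_simps)
      then have "cmod (w + of_real d * x - z) = d * cmod (x - (z - w) / of_real d)"
        using d by (simp add: norm_mult)
      also have "\<dots> < \<kappa> / 2 * d" using x d by simp
      finally show "z \<in> (\<Union>x\<in>k. F x)" using x z by (auto simp: F_def dist_norm)
    qed
    then have "measure lebesgue (E \<inter> P) \<le> measure lebesgue (\<Union>x\<in>k. F x)"
      using FM k(1) E PM
      by (intro measure_mono_fmeasurable fmeasurable.finite_UN) auto
    also have "\<dots> \<le> (\<Sum>x\<in>k. measure lebesgue (F x))"
      using FM k(1) by (intro measure_UNION_le) auto
    also have "\<dots> \<le> (\<Sum>x\<in>k. c * \<gamma> * d\<^sup>2)" by (intro sum_mono Fsmall)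
    also have "\<dots> = card k * (c * \<gamma> * d\<^sup>2)" by simp
    also have "\<dots> < (card k + 1) * (c * \<gamma> * d\<^sup>2)" using c \<gamma> d by simp
    also have "\<dots> = (card k + 1) * c * (\<gamma> * d\<^sup>2)" by simp
    also have "(card k + 1) * c = pi * (r / 4)\<^sup>2"
    proof -
      have "real (card k + 1) \<noteq> 0" by simp
      then show ?thesis
        unfolding c_def times_divide_eq_right by (rule nonzero_mult_div_cancel_left)
    qed
    also have "pi * (r / 4)\<^sup>2 * (\<gamma> * d\<^sup>2) = \<gamma> * (pi * (r / 4 * d)\<^sup>2)"
      by (simp add: power_mult_distrib power_divide)
    also have "\<dots> \<le> \<gamma> * measure lebesgue P"
      unfolding P_def d_def using \<gamma> by (intro mult_left_mono measure_pseudohyperbolic_disk_ge w r) auto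
    finally show False using dense by (simp add: P_def)
  qed
  show ?thesis by (intro exI[of _ c] conjI c allI impI main)
qed

text \<open>
  The estimate at a good point. The hypothesis on the integral over \<open>{z. near A w z}\<close> bounds \<open>f\<close> near
  \<open>w\<close> by a multiple of \<open>|f(w)|\<close>. Around the point \<open>a\<close> given by pigeonhole, the disks covering the
  sublevel set have total area of order \<open>\<delta>^2\<close>, so that for \<open>\<delta> = \<theta> \<gamma>\<close> they miss at least
  half of the part of \<open>E\<close> in question. One factor \<open>\<gamma>\<close> in the result comes from the area of this
  part and \<open>\<gamma>^{N p}\<close> from the size of \<open>|f|^p\<close> on it.
\<close>
lemma local_lower_bound:
  fixes p r :: real
  assumes p: "p > 0" and r: "0 < r" "r < 1"
  shows "\<exists>A>0. \<forall>K>0. \<exists>L>0. \<exists>c>0. \<forall>w f E \<gamma>. w \<in> unit_disk \<longrightarrow> f holomorphic_on unit_disk \<longrightarrow>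
           E \<in> sets borel \<longrightarrow> \<gamma> > 0 \<longrightarrow>
           \<gamma> * measure lebesgue (pseudohyperbolic_disk w r) \<le> measure lebesgue (E \<inter> pseudohyperbolic_disk w r) \<longrightarrow>
           (\<integral>\<^sup>+z\<in>{z. near A w z}. ennreal (cmod (f z) powr p) \<partial>lborel)
             \<le> ennreal (K * (cmod (f w) powr p * (disk_defect w)\<^sup>2)) \<longrightarrow>
           ennreal (c * \<gamma> powr L * (cmod (f w) powr p * (disk_defect w)\<^sup>2))
             \<le> (\<integral>\<^sup>+z\<in>{z. near A w z} \<inter> E. ennreal (cmod (f z) powr p) \<partial>lborel)"
proof -
  define A1 where "A1 = r / (1 - r)"
  define A2 where "A2 = (1 + r) / (1 - r)"
  \<comment> \<open>\<open>A1\<close> reaches from \<open>w\<close> to \<open>a\<close>, \<open>A2\<close> covers the disk around \<open>a\<close> used for the Moebius expansion, and \<open>A\<close> leaves room for the sup bound.\<close>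
  define B where "B = A1 + A2 + 2 * A1 * A2"
  define A where "A = 2 * B + 1 / 2"
  have A1: "A1 > 0" and A2: "A2 \<ge> 1" using r by (auto simp: A1_def A2_def field_simps)
  have "A1 * A2 \<ge> 0" using A1 A2 by simp
  then have B: "B > 0" using A1 A2 unfolding B_def mult.assoc by linarith
  have "A1 \<le> B" using A2 \<open>A1 * A2 \<ge> 0\<close> unfolding B_def mult.assoc by linarith
  then have A12: "A1 + (1 / 2) + 2 * A1 * (1 / 2) \<le> A" unfolding A_def by simp
  have A: "A > 0" using B by (simp add: A_def)
  have "\<exists>L>0. \<exists>c>0. \<forall>w f E \<gamma>. w \<in> unit_disk \<longrightarrow> f holomorphic_on unit_disk \<longrightarrow>
           E \<in> sets borel \<longrightarrow> \<gamma> > 0 \<longrightarrow>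
           \<gamma> * measure lebesgue (pseudohyperbolic_disk w r) \<le> measure lebesgue (E \<inter> pseudohyperbolic_disk w r) \<longrightarrow>
           (\<integral>\<^sup>+z\<in>{z. near A w z}. ennreal (cmod (f z) powr p) \<partial>lborel)
             \<le> ennreal (K * (cmod (f w) powr p * (disk_defect w)\<^sup>2)) \<longrightarrow>
           ennreal (c * \<gamma> powr L * (cmod (f w) powr p * (disk_defect w)\<^sup>2))
             \<le> (\<integral>\<^sup>+z\<in>{z. near A w z} \<inter> E. ennreal (cmod (f z) powr p) \<partial>lborel)"
    if K: "K > 0" for K
  proof -
    obtain K' where "K' > 0" and K': "\<forall>w f M. f holomorphic_on unit_disk \<longrightarrow> M \<ge> 0 \<longrightarrow>
           (\<integral>\<^sup>+z\<in>{z. near (2 * B + 1 / 2) w z}. ennreal (cmod (f z) powr p) \<partial>lborel)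
             \<le> ennreal (K * (M powr p * (disk_defect w)\<^sup>2)) \<longrightarrow>
           (\<forall>z. near B w z \<longrightarrow> cmod (f z) \<le> K' * M)"
      using sup_bound_of_local_integral[OF p less_imp_le[OF B] K] by (elim exE conjE)
    obtain \<eta> N b where \<eta>: "\<eta> > 0" "\<eta> \<le> 1" and b: "b > 0" and
      cover: "\<forall>a w f M \<delta>. a \<in> unit_disk \<longrightarrow> w \<in> unit_disk \<longrightarrow>
           pseudohyperbolic_dist a w \<le> r \<longrightarrow> f holomorphic_on unit_disk \<longrightarrow> M > 0 \<longrightarrow> M \<le> cmod (f w) \<longrightarrow>
           (\<forall>z. near ((1 + r) / (1 - r)) a z \<longrightarrow> cmod (f z) \<le> K' * M) \<longrightarrow> 0 < \<delta> \<longrightarrow> \<delta> < 1 \<longrightarrow>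
           (\<exists>T. finite T \<and> card T \<le> N \<and>
              {z \<in> ball a (\<eta> * (disk_defect a / 4)). cmod (f z) \<le> b * \<delta> ^ N * M}
                \<subseteq> (\<Union>t\<in>T. ball t (\<delta> * (disk_defect a / 4))))"
      using sublevel_set_cover_disk_point[OF r, of K'] by (elim exE conjE)
    define \<kappa> where "\<kappa> = \<eta> / (4 * (1 + 2 * A1))"
    have \<kappa>: "\<kappa> > 0" using \<eta> A1 by (simp add: \<kappa>_def)
    obtain c where c: "c > 0" and conc: "\<forall>w E \<gamma>. w \<in> unit_disk \<longrightarrow> E \<in> sets lebesgue \<longrightarrow> \<gamma> > 0 \<longrightarrow>
           \<gamma> * measure lebesgue (pseudohyperbolic_disk w r) \<le> measure lebesgue (E \<inter> pseudohyperbolic_disk w r) \<longrightarrow>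
           (\<exists>a\<in>pseudohyperbolic_disk w r.
              c * \<gamma> * (disk_defect w)\<^sup>2 \<le> measure lebesgue (E \<inter> ball a (\<kappa> * disk_defect w)))"
      using concentration_in_small_ball[OF r \<kappa>] by (elim exE conjE)
    \<comment> \<open>Small enough that \<open>N\<close> disks of radius \<open>\<theta> \<gamma> s\<close> cover at most half of the measure found by pigeonhole.\<close>
    define \<theta> where "\<theta> = min (1 / 2) (8 * c / (pi * (1 + 2 * A1)\<^sup>2 * (real N + 1)))"
    have \<theta>: "\<theta> > 0" "\<theta> \<le> 1 / 2" using c A1 by (auto simp: \<theta>_def add_pos_pos)
    have \<theta>N: "\<theta> * (pi * (1 + 2 * A1)\<^sup>2 * (real N + 1)) \<le> 8 * c"
    proof -
      have "pi * (1 + 2 * A1)\<^sup>2 * (real N + 1) > 0" using A1 by (intro mult_pos_pos) auto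
      then show ?thesis by (simp add: \<theta>_def flip: pos_le_divide_eq)
    qed
    define C where "C = (b * \<theta> ^ N) powr p * (c / 2)"
    have C: "C > 0" using b \<theta> c by (simp add: C_def)
    define L where "L = N * p + 1"
    have L: "L > 0" using p by (simp add: L_def add_nonneg_pos)
    have "ennreal (C * \<gamma> powr L * (cmod (f w) powr p * (disk_defect w)\<^sup>2))
             \<le> (\<integral>\<^sup>+z\<in>{z. near A w z} \<inter> E. ennreal (cmod (f z) powr p) \<partial>lborel)"
      if w: "w \<in> unit_disk" and f: "f holomorphic_on unit_disk" and E: "E \<in> sets borel" and \<gamma>: "\<gamma> > 0"
        and dense: "\<gamma> * measure lebesgue (pseudohyperbolic_disk w r) \<le> measure lebesgue (E \<inter> pseudohyperbolic_disk w r)"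
        and int: "(\<integral>\<^sup>+z\<in>{z. near A w z}. ennreal (cmod (f z) powr p) \<partial>lborel)
             \<le> ennreal (K * (cmod (f w) powr p * (disk_defect w)\<^sup>2))" for w f E \<gamma>
    proof (cases "f w = 0")
      case True
      then show ?thesis by simp
    next
      case False
      define M where "M = cmod (f w)"
      define d where "d = disk_defect w"
      have M: "M > 0" using False by (simp add: M_def)
      have d: "d > 0" using disk_defect_pos[OF w] by (simp add: d_def)
      have EL: "E \<in> sets lebesgue" using E by (metis sets_completionI_sets sets_lborel)
      \<comment> \<open>A density cannot exceed 1; this turns \<open>\<delta>^2\<close> into a bound linear in \<open>\<gamma>\<close>.\<close>
      have "\<gamma> \<le> 1"
      proof -
        have "\<gamma> * measure lebesgue (pseudohyperbolic_disk w r) \<le> 1 * measure lebesgue (pseudohyperbolic_disk w r)"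
          unfolding mult_1 using EL pseudohyperbolic_disk_lmeasurable[of w r]
          by (intro order_trans[OF dense] measure_mono_fmeasurable) auto
        moreover have "measure lebesgue (pseudohyperbolic_disk w r) > 0"
          using d r
          by (intro less_le_trans[OF _ measure_pseudohyperbolic_disk_ge[OF w r]]) (simp add: d_def)
        ultimately show ?thesis by simp
      qed
      define \<delta> where "\<delta> = \<theta> * \<gamma>"
      have "\<delta> \<le> \<theta> * 1"
        unfolding \<delta>_def using \<theta> \<open>\<gamma> \<le> 1\<close> by (intro mult_left_mono) auto
      moreover have "0 < \<delta>" using \<theta> \<gamma> by (simp add: \<delta>_def)
      ultimately have \<delta>: "0 < \<delta>" "\<delta> < 1" using \<theta> by auto
      obtain a where a: "a \<in> pseudohyperbolic_disk w r"
        and big: "c * \<gamma> * d\<^sup>2 \<le> measure lebesgue (E \<inter> ball a (\<kappa> * d))"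
        using conc[rule_format, OF w EL \<gamma> dense] unfolding d_def by blast
      have aD: "a \<in> unit_disk" and wa: "pseudohyperbolic_dist w a \<le> r"
        using a by (auto simp: pseudohyperbolic_disk_def)
      have nwa: "near A1 w a"
        unfolding A1_def by (rule near_if_pseudohyperbolic_dist_le[OF w aD _ _ wa]) (use r in auto)
      have da: "d \<le> (1 + 2 * A1) * disk_defect a" "disk_defect a \<le> (1 + 2 * A1) * d" "disk_defect a > 0"
        using near_disk_defect_le[OF nwa] near_disk_defect_le[of A1 a w] nwa disk_defect_pos[OF aD]
        by (auto simp: d_def near_sym)
      define s where "s = disk_defect a / 4"
      have s: "s > 0" "s \<le> (1 + 2 * A1) * d / 4" using da by (auto simp: s_def)
      have "\<kappa> * d \<le> \<kappa> * ((1 + 2 * A1) * disk_defect a)" using da \<kappa> by (intro mult_left_mono) auto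
      also have "\<dots> = \<kappa> * (1 + 2 * A1) * disk_defect a" by simp
      also have "\<kappa> * (1 + 2 * A1) = \<eta> / 4" using A1 unfolding \<kappa>_def by (simp add: divide_simps)
      also have "\<eta> / 4 * disk_defect a = \<eta> * s" by (simp add: s_def)
      finally have ball_sub: "ball a (\<kappa> * d) \<subseteq> ball a (\<eta> * s)" by auto
      have ball_near: "near A w z" if "z \<in> ball a (\<kappa> * d)" for z
      proof -
        have "\<eta> * s \<le> 1 * s" using \<eta> s by (intro mult_right_mono) auto
        then have "cmod (z - a) < disk_defect a / 4"
          using that ball_sub by (auto simp: s_def dist_norm norm_minus_commute)
        from near_trans[OF nwa near_ball[OF aD this]] A1 show ?thesis
          by (intro near_mono[OF _ A12]) auto
      qed
      have bound: "cmod (f z) \<le> K' * M" if "near ((1 + r) / (1 - r)) a z" for z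
      proof -
        have "near B w z" using near_trans[OF nwa that] A1 A2 by (simp add: B_def A2_def)
        then show ?thesis
          using K'[rule_format, OF f norm_ge_zero int[unfolded A_def]] by (simp add: M_def)
      qed
      obtain T where T: "finite T" "card T \<le> N"
          "{z \<in> ball a (\<eta> * s). cmod (f z) \<le> b * \<delta> ^ N * M} \<subseteq> (\<Union>t\<in>T. ball t (\<delta> * s))"
        using cover[rule_format, OF aD w _ f M _ bound \<delta>] wa
        unfolding pseudohyperbolic_dist_commute[of a w] s_def by (auto simp: M_def)
      define U where "U = (\<Union>t\<in>T. ball t (\<delta> * s))"
      have U: "U \<in> sets borel" unfolding U_def by (intro borel_open) auto
      have "measure lebesgue U \<le> (\<Sum>t\<in>T. measure lebesgue (ball t (\<delta> * s)))"
        unfolding U_def using T(1) by (intro measure_UNION_le) auto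
      also have "\<dots> = card T * (pi * (\<delta> * s)\<^sup>2)"
        using \<delta> s by (simp add: content_ball unit_ball_vol_2)
      also have "\<dots> \<le> (real N + 1) * (pi * (\<theta> * \<gamma> * ((1 + 2 * A1) * d / 4)\<^sup>2))"
      proof (intro mult_mono)
        have "(\<delta> * s)\<^sup>2 \<le> (\<theta> * \<gamma>) * ((1 + 2 * A1) * d / 4)\<^sup>2"
          unfolding power_mult_distrib[of \<delta>]
        proof (intro mult_mono power_mono)
          show "\<delta>\<^sup>2 \<le> \<theta> * \<gamma>" using \<delta> by (simp add: power2_eq_square mult_left_le flip: \<delta>_def)
        qed (use s \<theta> \<gamma> in auto)
        then show "(\<delta> * s)\<^sup>2 \<le> \<theta> * \<gamma> * ((1 + 2 * A1) * d / 4)\<^sup>2" .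
      qed (use T(2) in auto)
      also have "\<dots> = \<theta> * (pi * (1 + 2 * A1)\<^sup>2 * (real N + 1)) * (\<gamma> * d\<^sup>2 / 16)"
        by (simp add: power_mult_distrib power_divide)
      also have "\<dots> \<le> 8 * c * (\<gamma> * d\<^sup>2 / 16)" using \<theta>N \<gamma> by (intro mult_right_mono) auto
      finally have Usmall: "measure lebesgue U \<le> c * \<gamma> * d\<^sup>2 / 2" by (simp add: mult_ac)
      define G where "G = E \<inter> ball a (\<kappa> * d) - U"
      have G: "G \<in> sets borel" unfolding G_def using E U by auto
      have UM: "U \<in> lmeasurable" unfolding U_def using T(1) by (intro fmeasurable.finite_UN) auto
      have BM: "E \<inter> ball a (\<kappa> * d) \<in> lmeasurable"
        using fmeasurable_Int_fmeasurable[OF lmeasurable_ball EL] by (simp add: Int_commute)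
      have GM: "G \<in> lmeasurable" unfolding G_def by (intro fmeasurable_Diff BM) (use UM in auto)
      have "measure lebesgue (E \<inter> ball a (\<kappa> * d)) \<le> measure lebesgue (G \<union> U)"
        using BM GM UM by (intro measure_mono_fmeasurable) (auto simp: G_def intro!: fmeasurable.Un)
      also have "\<dots> \<le> measure lebesgue G + measure lebesgue U"
        using GM UM by (intro measure_Un_le) auto
      finally have Gbig: "c * \<gamma> * d\<^sup>2 / 2 \<le> measure lebesgue G" using big Usmall by simp
      have large: "b * \<delta> ^ N * M \<le> cmod (f z)" if "z \<in> G" for z
      proof (rule ccontr)
        assume "\<not> ?thesis"
        then have "z \<in> {z \<in> ball a (\<eta> * s). cmod (f z) \<le> b * \<delta> ^ N * M}"
          using that ball_sub by (auto simp: G_def)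
        then have "z \<in> U" using T(3) unfolding U_def by blast
        then show False using that by (simp add: G_def)
      qed
      have nonneg: "0 \<le> b * \<delta> ^ N * M" using b \<delta> M by simp
      have "C * \<gamma> powr L * (M powr p * d\<^sup>2) = (b * \<delta> ^ N * M) powr p * (c * \<gamma> * d\<^sup>2 / 2)"
      proof -
        have "(\<gamma> ^ N) powr p * \<gamma> = \<gamma> powr L"
          using \<gamma> by (simp add: L_def powr_add powr_powr flip: powr_realpow)
        moreover have "(b * \<delta> ^ N * M) powr p = (b * \<theta> ^ N) powr p * (\<gamma> ^ N) powr p * M powr p"
          using b \<theta> \<gamma> M by (simp add: \<delta>_def power_mult_distrib powr_mult)
        ultimately show ?thesis by (simp add: C_def)
      qed
      also have "\<dots> \<le> (b * \<delta> ^ N * M) powr p * measure lebesgue G"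
        using Gbig by (intro mult_left_mono) auto
      finally have "ennreal (C * \<gamma> powr L * (M powr p * d\<^sup>2))
          \<le> ennreal ((b * \<delta> ^ N * M) powr p * measure lebesgue G)" by (rule ennreal_leI)
      also have "\<dots> = ennreal ((b * \<delta> ^ N * M) powr p) * emeasure lborel G"
      proof -
        have "emeasure lborel G = emeasure lebesgue G" using G by (simp add: emeasure_completion)
        also have "\<dots> = ennreal (measure lebesgue G)" using GM by (rule emeasure_eq_measure2)
        finally show ?thesis by (simp add: ennreal_mult)
      qed
      also have "\<dots> = (\<integral>\<^sup>+z\<in>G. ennreal ((b * \<delta> ^ N * M) powr p) \<partial>lborel)"
        using G by (subst nn_integral_cmult_indicator) auto
      also have "\<dots> \<le> (\<integral>\<^sup>+z\<in>{z. near A w z} \<inter> E. ennreal (cmod (f z) powr p) \<partial>lborel)"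
        using large ball_near nonneg p
        by (intro nn_integral_mono) (auto simp: indicator_def G_def intro!: ennreal_leI powr_mono2)
      finally show ?thesis unfolding M_def d_def .
    qed
    then show ?thesis using C L by blast
  qed
  then show ?thesis using A by blast
qed

section \<open>From local to global\<close>

text \<open>
  The Bergman weight is essentially constant on neighbourhoods, so that the local estimate can be
  applied to unweighted integrals.
\<close>
lemma near_defect_powr_le:
  assumes "near A w z"
  shows "disk_defect w powr \<alpha> \<le> (1 + 2 * A) powr \<bar>\<alpha>\<bar> * disk_defect z powr \<alpha>"
proof -
  have pos: "0 < disk_defect w" "0 < disk_defect z"
    using assms by (auto simp: near_def intro!: disk_defect_pos)
  have wz: "disk_defect w \<le> (1 + 2 * A) * disk_defect z" "disk_defect z \<le> (1 + 2 * A) * disk_defect w"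
    using near_disk_defect_le assms near_sym by blast+
  have A: "0 < 1 + 2 * A" using wz(1) pos by (meson less_le_trans zero_less_mult_pos2)
  show ?thesis
  proof (cases "\<alpha> \<ge> 0")
    case True
    then have "disk_defect w powr \<alpha> \<le> ((1 + 2 * A) * disk_defect z) powr \<alpha>"
      using wz pos by (intro powr_mono2) auto
    then show ?thesis using True A pos by (simp add: powr_mult)
  next
    case False
    have "disk_defect z / (1 + 2 * A) \<le> disk_defect w"
      using wz(2) A by (simp add: divide_le_eq mult.commute)
    then have "disk_defect w powr \<alpha> \<le> (disk_defect z / (1 + 2 * A)) powr \<alpha>"
      using False pos A by (intro powr_mono2') auto
    then show ?thesis using False A pos by (simp add: powr_divide powr_minus_divide)
  qed
qed

definition bergman_integrand :: "real \<Rightarrow> real \<Rightarrow> (complex \<Rightarrow> complex) \<Rightarrow> complex \<Rightarrow> ennreal" where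
  "bergman_integrand p \<alpha> f z =
     ennreal (disk_defect z powr \<alpha> * cmod (f z) powr p) * indicator unit_disk z"

text \<open>
  Each point \<open>w\<close> is either bad, and then the integrand \<open>u\<close> at \<open>w\<close> is at most \<open>1 / (2 C)\<close> times its
  local average, or good, and then \<open>u(w)\<close> is at most a multiple of \<open>\<gamma>^{-L}\<close> times the local average
  of \<open>u\<close> restricted to \<open>E\<close>. Adding the two bounds gives an inequality valid everywhere, whose
  integral has half of the full norm on the right; finiteness of the norm allows this half to
  be absorbed.
\<close>
lemma weighted_integral_lower_bound:
  fixes p \<alpha> r :: real
  assumes p: "p > 0" and r: "0 < r" "r < 1"
  shows "\<exists>L>0. \<exists>c>0. \<forall>\<gamma>>0. \<forall>E\<in>sets borel. \<forall>f. f holomorphic_on unit_disk \<longrightarrow>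
           (\<integral>\<^sup>+z. bergman_integrand p \<alpha> f z \<partial>lborel) < \<infinity> \<longrightarrow> pseudohyperbolic_dense \<gamma> r E \<longrightarrow>
           ennreal (c * \<gamma> powr L) * (\<integral>\<^sup>+z. bergman_integrand p \<alpha> f z \<partial>lborel)
             \<le> (\<integral>\<^sup>+z\<in>E. bergman_integrand p \<alpha> f z \<partial>lborel)"
proof -
  obtain A where A: "A > 0" and local: "\<forall>K>0. \<exists>L>0. \<exists>c>0. \<forall>w f E \<gamma>. w \<in> unit_disk \<longrightarrow> f holomorphic_on unit_disk \<longrightarrow>
           E \<in> sets borel \<longrightarrow> \<gamma> > 0 \<longrightarrow>
           \<gamma> * measure lebesgue (pseudohyperbolic_disk w r) \<le> measure lebesgue (E \<inter> pseudohyperbolic_disk w r) \<longrightarrow>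
           (\<integral>\<^sup>+z\<in>{z. near A w z}. ennreal (cmod (f z) powr p) \<partial>lborel)
             \<le> ennreal (K * (cmod (f w) powr p * (disk_defect w)\<^sup>2)) \<longrightarrow>
           ennreal (c * \<gamma> powr L * (cmod (f w) powr p * (disk_defect w)\<^sup>2))
             \<le> (\<integral>\<^sup>+z\<in>{z. near A w z} \<inter> E. ennreal (cmod (f z) powr p) \<partial>lborel)"
    using local_lower_bound[OF assms] by (elim exE conjE)
  obtain C where C: "C > 0" and average: "\<forall>u. u \<in> borel_measurable borel \<longrightarrow>
           (\<integral>\<^sup>+w. local_average A u w \<partial>lborel) \<le> ennreal C * (\<integral>\<^sup>+z\<in>unit_disk. u z \<partial>lborel)"
    using integral_local_average_le[OF A] by (elim exE conjE)
  define \<Lambda> where "\<Lambda> = (1 + 2 * A) powr \<bar>\<alpha>\<bar>"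
  have \<Lambda>: "\<Lambda> > 0" using A by (simp add: \<Lambda>_def)
  have "2 * C * \<Lambda> > 0" using C \<Lambda> by simp
  from local[rule_format, OF this] obtain L c where L: "L > 0" and c: "c > 0" and
    loc: "\<forall>w f E \<gamma>. w \<in> unit_disk \<longrightarrow> f holomorphic_on unit_disk \<longrightarrow>
           E \<in> sets borel \<longrightarrow> \<gamma> > 0 \<longrightarrow>
           \<gamma> * measure lebesgue (pseudohyperbolic_disk w r) \<le> measure lebesgue (E \<inter> pseudohyperbolic_disk w r) \<longrightarrow>
           (\<integral>\<^sup>+z\<in>{z. near A w z}. ennreal (cmod (f z) powr p) \<partial>lborel)
             \<le> ennreal (2 * C * \<Lambda> * (cmod (f w) powr p * (disk_defect w)\<^sup>2)) \<longrightarrow>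
           ennreal (c * \<gamma> powr L * (cmod (f w) powr p * (disk_defect w)\<^sup>2))
             \<le> (\<integral>\<^sup>+z\<in>{z. near A w z} \<inter> E. ennreal (cmod (f z) powr p) \<partial>lborel)"
    by (elim exE conjE)
  define c' where "c' = c / (2 * \<Lambda> * C)"
  have c': "c' > 0" using c C \<Lambda> by (simp add: c'_def)
  have main: "ennreal (c' * \<gamma> powr L) * (\<integral>\<^sup>+z. bergman_integrand p \<alpha> f z \<partial>lborel)
      \<le> (\<integral>\<^sup>+z\<in>E. bergman_integrand p \<alpha> f z \<partial>lborel)"
    if \<gamma>: "\<gamma> > 0" and E: "E \<in> sets borel" and f: "f holomorphic_on unit_disk"
      and fin: "(\<integral>\<^sup>+z. bergman_integrand p \<alpha> f z \<partial>lborel) < \<infinity>"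
      and dense: "pseudohyperbolic_dense \<gamma> r E" for \<gamma> E f
  proof -
    define u where "u = bergman_integrand p \<alpha> f"
    have u: "u = (\<lambda>z. ennreal (disk_defect z powr \<alpha> * cmod (f z) powr p) * indicator unit_disk z)"
      unfolding u_def bergman_integrand_def ..
    \<comment> \<open>Outside the disk \<open>f\<close> is arbitrary, so only its truncation is known to be measurable.\<close>
    have f0: "(\<lambda>z. indicator unit_disk z *\<^sub>R f z) \<in> borel_measurable borel"
      by (intro borel_measurable_continuous_on_indicator holomorphic_on_imp_continuous_on f) simp
    have u': "u = (\<lambda>z. ennreal (disk_defect z powr \<alpha> * cmod (indicator unit_disk z *\<^sub>R f z) powr p)
        * indicator unit_disk z)"
      unfolding u by (auto simp: indicator_def)
    have [measurable]: "unit_disk \<in> sets borel" by simp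
    have um [measurable]: "u \<in> borel_measurable borel"
      unfolding u' using f0 by measurable
    note [measurable] = E
    define v where "v = (\<lambda>z. u z * indicator E z)"
    have vm [measurable]: "v \<in> borel_measurable borel" unfolding v_def by measurable
    define P where "P = c * \<gamma> powr L"
    have P: "P > 0" using c \<gamma> by (simp add: P_def)
    have meas: "(\<lambda>z. h z * indicator {z. near A w z} z) \<in> borel_measurable lborel"
      if [measurable]: "h \<in> borel_measurable borel" for w and h :: "complex \<Rightarrow> ennreal"
      by measurable
    have compare: "(\<integral>\<^sup>+z\<in>{z. near A w z} \<inter> F. ennreal (cmod (f z) powr p) \<partial>lborel)
        \<le> ennreal (\<Lambda> / disk_defect w powr \<alpha>) * (\<integral>\<^sup>+z\<in>{z. near A w z}. u z * indicator F z \<partial>lborel)"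
      if w: "w \<in> unit_disk" and [measurable]: "F \<in> sets borel" for w F
    proof -
      have "(\<integral>\<^sup>+z\<in>{z. near A w z} \<inter> F. ennreal (cmod (f z) powr p) \<partial>lborel)
          \<le> (\<integral>\<^sup>+z. ennreal (\<Lambda> / disk_defect w powr \<alpha>) * (u z * indicator F z * indicator {z. near A w z} z) \<partial>lborel)"
      proof (rule nn_integral_mono)
        fix z
        show "ennreal (cmod (f z) powr p) * indicator ({z. near A w z} \<inter> F) z
            \<le> ennreal (\<Lambda> / disk_defect w powr \<alpha>) * (u z * indicator F z * indicator {z. near A w z} z)"
        proof (cases "near A w z \<and> z \<in> F")
          case True
          then have z: "z \<in> unit_disk" by (auto simp: near_def)
          have dw: "disk_defect w powr \<alpha> > 0" using disk_defect_pos[OF w] by simp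
          have "disk_defect w powr \<alpha> * cmod (f z) powr p
              \<le> \<Lambda> * disk_defect z powr \<alpha> * cmod (f z) powr p"
            using near_defect_powr_le[of A w z \<alpha>] True unfolding \<Lambda>_def by (intro mult_right_mono) auto
          then have "cmod (f z) powr p
              \<le> \<Lambda> / disk_defect w powr \<alpha> * (disk_defect z powr \<alpha> * cmod (f z) powr p)"
            using dw by (simp add: field_simps)
          then show ?thesis
            using True z \<Lambda> dw by (simp add: u ennreal_leI flip: ennreal_mult)
        qed (auto simp: indicator_def)
      qed
      also have "\<dots> = ennreal (\<Lambda> / disk_defect w powr \<alpha>) * (\<integral>\<^sup>+z\<in>{z. near A w z}. u z * indicator F z \<partial>lborel)"
        by (intro nn_integral_cmult meas) measurable
      finally show ?thesis .
    qed
    have pointwise: "u w \<le> ennreal (1 / (2 * C)) * local_average A u w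
        + ennreal (\<Lambda> / P) * local_average A v w" for w
    proof (cases "w \<in> unit_disk")
      case False
      then show ?thesis by (simp add: u)
    next
      case w: True
      define d where "d = disk_defect w"
      have d: "d > 0" using disk_defect_pos[OF w] by (simp add: d_def)
      define m where "m = cmod (f w) powr p"
      have m: "m \<ge> 0" by (simp add: m_def)
      have uw: "u w = ennreal (d powr \<alpha> * m)" using w by (simp add: u d_def m_def)
      define X where "X = (\<integral>\<^sup>+z\<in>{z. near A w z}. u z \<partial>lborel)"
      define Y where "Y = (\<integral>\<^sup>+z\<in>{z. near A w z}. v z \<partial>lborel)"
      have avX: "local_average A u w = ennreal (1 / d\<^sup>2) * X"
        by (simp add: local_average_def X_def d_def)
      have avY: "local_average A v w = ennreal (1 / d\<^sup>2) * Y"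
        by (simp add: local_average_def Y_def d_def)
      show ?thesis
      proof (cases "local_average A u w \<le> ennreal (2 * C) * u w")
        case False
        have "u w = ennreal (1 / (2 * C)) * (ennreal (2 * C) * u w)"
          using C by (simp flip: mult.assoc ennreal_mult)
        also have "\<dots> \<le> ennreal (1 / (2 * C)) * local_average A u w"
          using False by (intro mult_left_mono) auto
        finally show ?thesis by (rule order_trans) simp
      next
        case True
        have "X = ennreal (d\<^sup>2) * (ennreal (1 / d\<^sup>2) * X)"
          using d by (simp flip: mult.assoc ennreal_mult)
        also have "\<dots> \<le> ennreal (d\<^sup>2) * (ennreal (2 * C) * u w)"
          using True unfolding avX by (intro mult_left_mono) auto
        also have "\<dots> = ennreal (d\<^sup>2 * (2 * C * (d powr \<alpha> * m)))"
          using C m by (simp add: uw flip: ennreal_mult)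
        finally have X: "X \<le> ennreal (d\<^sup>2 * (2 * C * (d powr \<alpha> * m)))" .
        have "(\<integral>\<^sup>+z\<in>{z. near A w z}. ennreal (cmod (f z) powr p) \<partial>lborel) \<le> ennreal (\<Lambda> / d powr \<alpha>) * X"
          using compare[OF w, of UNIV] by (simp add: X_def d_def)
        also have "\<dots> \<le> ennreal (\<Lambda> / d powr \<alpha>) * ennreal (d\<^sup>2 * (2 * C * (d powr \<alpha> * m)))"
          using X by (intro mult_left_mono) auto
        also have "\<dots> = ennreal (\<Lambda> / d powr \<alpha> * (d\<^sup>2 * (2 * C * (d powr \<alpha> * m))))"
          using \<Lambda> C m by (intro ennreal_mult[symmetric]) auto
        also have "\<Lambda> / d powr \<alpha> * (d\<^sup>2 * (2 * C * (d powr \<alpha> * m))) = 2 * C * \<Lambda> * (m * d\<^sup>2)"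
          using d by simp
        finally have good: "(\<integral>\<^sup>+z\<in>{z. near A w z}. ennreal (cmod (f z) powr p) \<partial>lborel)
            \<le> ennreal (2 * C * \<Lambda> * (cmod (f w) powr p * (disk_defect w)\<^sup>2))" by (simp only: m_def d_def)
        have dens: "\<gamma> * measure lebesgue (pseudohyperbolic_disk w r) \<le> measure lebesgue (E \<inter> pseudohyperbolic_disk w r)"
        proof -
          have "measure lebesgue (pseudohyperbolic_disk w r) > 0"
            using d r by (intro less_le_trans[OF _ measure_pseudohyperbolic_disk_ge[OF w r]]) (simp add: d_def)
          moreover have "\<gamma> \<le> measure lebesgue (E \<inter> pseudohyperbolic_disk w r) / measure lebesgue (pseudohyperbolic_disk w r)"
            using dense w unfolding pseudohyperbolic_dense_def by blast
          ultimately show ?thesis by (simp only: pos_le_divide_eq)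
        qed
        have "ennreal (P * (m * d\<^sup>2)) \<le> (\<integral>\<^sup>+z\<in>{z. near A w z} \<inter> E. ennreal (cmod (f z) powr p) \<partial>lborel)"
          using loc[rule_format, OF w f E \<gamma> dens good] unfolding P_def m_def d_def .
        also have "\<dots> \<le> ennreal (\<Lambda> / d powr \<alpha>) * Y"
          using compare[OF w E] by (simp add: Y_def v_def d_def)
        finally have Y: "ennreal (P * (m * d\<^sup>2)) \<le> ennreal (\<Lambda> / d powr \<alpha>) * Y" .
        have "u w = ennreal (d powr \<alpha> / (P * d\<^sup>2)) * ennreal (P * (m * d\<^sup>2))"
          using P d m by (simp add: uw flip: ennreal_mult)
        also have "\<dots> \<le> ennreal (d powr \<alpha> / (P * d\<^sup>2)) * (ennreal (\<Lambda> / d powr \<alpha>) * Y)"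
          using Y by (intro mult_left_mono) auto
        also have "\<dots> = ennreal (d powr \<alpha> / (P * d\<^sup>2) * (\<Lambda> / d powr \<alpha>)) * Y"
          using P \<Lambda> by (simp add: mult.assoc[symmetric] flip: ennreal_mult)
        also have "d powr \<alpha> / (P * d\<^sup>2) * (\<Lambda> / d powr \<alpha>) = \<Lambda> / P * (1 / d\<^sup>2)"
          using d P by simp
        also have "ennreal (\<Lambda> / P * (1 / d\<^sup>2)) * Y = ennreal (\<Lambda> / P) * local_average A v w"
          using P \<Lambda> unfolding avY mult.assoc[symmetric] by (subst ennreal_mult) auto
        finally show ?thesis by (rule order_trans) simp
      qed
    qed
    define I where "I = (\<integral>\<^sup>+z. u z \<partial>lborel)"
    define J where "J = (\<integral>\<^sup>+z\<in>E. u z \<partial>lborel)"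
    have onI: "(\<integral>\<^sup>+z\<in>unit_disk. u z \<partial>lborel) = I"
      unfolding I_def u by (intro nn_integral_cong) (auto simp: indicator_def)
    have onJ: "(\<integral>\<^sup>+z\<in>unit_disk. v z \<partial>lborel) = J"
      unfolding J_def v_def u by (intro nn_integral_cong) (auto simp: indicator_def)
    have "I \<le> (\<integral>\<^sup>+w. ennreal (1 / (2 * C)) * local_average A u w + ennreal (\<Lambda> / P) * local_average A v w \<partial>lborel)"
      unfolding I_def by (rule nn_integral_mono) (rule pointwise)
    also have "\<dots> = ennreal (1 / (2 * C)) * (\<integral>\<^sup>+w. local_average A u w \<partial>lborel)
        + ennreal (\<Lambda> / P) * (\<integral>\<^sup>+w. local_average A v w \<partial>lborel)"
      by (subst nn_integral_add) (simp_all add: nn_integral_cmult)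
    also have "\<dots> \<le> ennreal (1 / (2 * C)) * (ennreal C * I) + ennreal (\<Lambda> / P) * (ennreal C * J)"
      using average[rule_format, OF um] average[rule_format, OF vm] unfolding onI onJ
      by (intro add_mono mult_left_mono) auto
    also have "\<dots> = ennreal (1 / 2) * I + ennreal (\<Lambda> / P * C) * J"
      using C P \<Lambda> by (simp flip: mult.assoc ennreal_mult)
    finally have le: "I \<le> ennreal (1 / 2) * I + ennreal (\<Lambda> / P * C) * J" .
    have "J \<le> I" unfolding I_def J_def by (intro nn_integral_mono) (auto simp: indicator_def)
    then have "J < \<infinity>" using fin unfolding I_def u_def by (rule le_less_trans)
    then obtain y where y: "J = ennreal y" "y \<ge> 0" by (cases J) auto
    obtain x where x: "I = ennreal x" "x \<ge> 0" using fin unfolding u_def[symmetric] I_def[symmetric] by (cases I) auto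
    have "ennreal (1 / 2 * x + \<Lambda> / P * C * y) = ennreal (1 / 2 * x) + ennreal (\<Lambda> / P * C * y)"
      using x y C P \<Lambda> by (intro ennreal_plus) auto
    also have "ennreal (1 / 2 * x) = ennreal (1 / 2) * ennreal x"
      using x by (intro ennreal_mult) auto
    also have "ennreal (\<Lambda> / P * C * y) = ennreal (\<Lambda> / P * C) * ennreal y"
      using y C P \<Lambda> by (intro ennreal_mult) auto
    finally have "ennreal x \<le> ennreal (1 / 2 * x + \<Lambda> / P * C * y)"
      using le unfolding x(1) y(1) by simp
    then have "x \<le> 1 / 2 * x + \<Lambda> / P * C * y"
      using x y C P \<Lambda> by (subst (asm) ennreal_le_iff) auto
    then have "P / (2 * \<Lambda> * C) * x \<le> y"
      using C P \<Lambda> by (simp add: field_simps)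
    then have "c' * \<gamma> powr L * x \<le> y" by (simp add: c'_def P_def)
    then show ?thesis
      unfolding u_def[symmetric] I_def[symmetric] J_def[symmetric] x y using c' x
      by (simp add: ennreal_leI flip: ennreal_mult)
  qed
  show ?thesis by (intro exI[of _ L] conjI L exI[of _ c'] c' allI impI ballI main)
qed

lemma weighted_integral_eq:
  assumes \<alpha>: "\<alpha> > -1" and F: "F \<in> sets borel" "F \<subseteq> unit_disk" and f: "f holomorphic_on unit_disk"
  shows "weighted_integral p \<alpha> F f = ennreal ((\<alpha> + 1) / pi) *
           (\<integral>\<^sup>+z\<in>F. bergman_integrand p \<alpha> f z \<partial>lborel)"
proof -
  define g where "g = (\<lambda>z. indicator unit_disk z *\<^sub>R f z)"
  have [measurable]: "unit_disk \<in> sets borel" "F \<in> sets borel" using F by simp_all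
  have g [measurable]: "g \<in> borel_measurable borel"
    unfolding g_def by (intro borel_measurable_continuous_on_indicator holomorphic_on_imp_continuous_on f) simp
  define h where "h = (\<lambda>z. ennreal (cmod (g z) powr p) * indicator F z)"
  define \<omega> where "\<omega> = (\<lambda>z. ennreal ((\<alpha> + 1) * disk_defect z powr \<alpha>))"
  have [measurable]: "h \<in> borel_measurable borel" unfolding h_def by measurable
  have [measurable]: "\<omega> \<in> borel_measurable borel" unfolding \<omega>_def by measurable
  have leb: "k \<in> borel_measurable lebesgue" if "k \<in> borel_measurable borel" for k :: "complex \<Rightarrow> ennreal"
    using that by (simp add: measurable_completion)
  have sets_area: "sets area_measure = sets lebesgue" by (simp add: area_measure_def)
  have area: "k \<in> borel_measurable area_measure" if "k \<in> borel_measurable borel" for k :: "complex \<Rightarrow> ennreal"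
    using leb[OF that] measurable_cong_sets[OF sets_area refl] by blast
  have "weighted_integral p \<alpha> F f = (\<integral>\<^sup>+z. h z \<partial>density area_measure \<omega>)"
    unfolding weighted_integral_def weighted_area_measure_def \<omega>_def disk_defect_def
    using F(2) by (intro nn_integral_cong) (auto simp: h_def g_def indicator_def)
  also have "\<dots> = (\<integral>\<^sup>+z. \<omega> z * h z \<partial>area_measure)"
    by (intro nn_integral_density area) measurable
  also have "\<dots> = (\<integral>\<^sup>+z. \<omega> z * h z * indicator unit_disk z \<partial>lebesgue) / emeasure lebesgue unit_disk"
    unfolding area_measure_def by (intro nn_integral_uniform_measure leb) (measurable, simp)
  also have "emeasure lebesgue unit_disk = ennreal pi"
    by (simp add: emeasure_completion emeasure_ball unit_ball_vol_2)
  also have "(\<integral>\<^sup>+z. \<omega> z * h z * indicator unit_disk z \<partial>lebesgue) / ennreal pi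
      = (\<integral>\<^sup>+z. \<omega> z * h z * indicator unit_disk z / ennreal pi \<partial>lborel)"
    unfolding nn_integral_completion by (intro nn_integral_divide[symmetric]) measurable
  also have "\<dots> = (\<integral>\<^sup>+z. ennreal ((\<alpha> + 1) / pi) *
      (ennreal (disk_defect z powr \<alpha> * cmod (g z) powr p) * indicator unit_disk z * indicator F z) \<partial>lborel)"
  proof (rule nn_integral_cong)
    fix z
    show "\<omega> z * h z * indicator unit_disk z / ennreal pi = ennreal ((\<alpha> + 1) / pi) *
      (ennreal (disk_defect z powr \<alpha> * cmod (g z) powr p) * indicator unit_disk z * indicator F z)"
      using \<alpha> by (auto simp: \<omega>_def h_def indicator_def divide_ennreal simp flip: ennreal_mult)
  qed
  also have "\<dots> = ennreal ((\<alpha> + 1) / pi) *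
      (\<integral>\<^sup>+z. ennreal (disk_defect z powr \<alpha> * cmod (g z) powr p) * indicator unit_disk z * indicator F z \<partial>lborel)"
    by (intro nn_integral_cmult) measurable
  also have "(\<integral>\<^sup>+z. ennreal (disk_defect z powr \<alpha> * cmod (g z) powr p) * indicator unit_disk z * indicator F z \<partial>lborel)
      = (\<integral>\<^sup>+z\<in>F. bergman_integrand p \<alpha> f z \<partial>lborel)"
    by (intro nn_integral_cong) (auto simp: g_def bergman_integrand_def indicator_def)
  finally show ?thesis .
qed

theorem theorem2:
  fixes p \<alpha> r :: real
  assumes "1 \<le> p" and "\<alpha> > -1" and "0 < r" and "r < 1"
  shows "\<exists>L>0. \<exists>c>0. \<forall>\<gamma>>0. \<forall>E\<in>sets lebesgue. \<forall>f\<in>bergman_space p \<alpha>.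
           E \<subseteq> unit_disk \<longrightarrow> pseudohyperbolic_dense \<gamma> r E \<longrightarrow>
             weighted_norm p \<alpha> E f \<ge> (\<gamma> / c) powr L * bergman_norm p \<alpha> f"
proof -
  have p: "p > 0" using assms by simp
  obtain L c where L: "L > 0" and c: "c > 0" and
    bound: "\<forall>\<gamma>>0. \<forall>E\<in>sets borel. \<forall>f. f holomorphic_on unit_disk \<longrightarrow>
           (\<integral>\<^sup>+z. bergman_integrand p \<alpha> f z \<partial>lborel) < \<infinity> \<longrightarrow> pseudohyperbolic_dense \<gamma> r E \<longrightarrow>
           ennreal (c * \<gamma> powr L) * (\<integral>\<^sup>+z. bergman_integrand p \<alpha> f z \<partial>lborel)
             \<le> (\<integral>\<^sup>+z\<in>E. bergman_integrand p \<alpha> f z \<partial>lborel)"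
    using weighted_integral_lower_bound[OF p assms(3,4), of \<alpha>] by (elim exE conjE)
  \<comment> \<open>Chosen so that \<open>(\<gamma> / k)^L = c \<gamma>^L\<close>.\<close>
  define k where "k = c powr (- 1 / L)"
  have k: "k > 0" using c by (simp add: k_def)
  have main: "weighted_norm p \<alpha> E f \<ge> (\<gamma> / k) powr (L / p) * bergman_norm p \<alpha> f"
    if \<gamma>: "\<gamma> > 0" and E: "E \<in> sets lebesgue" and fB: "f \<in> bergman_space p \<alpha>"
      and ED: "E \<subseteq> unit_disk" and dense: "pseudohyperbolic_dense \<gamma> r E" for \<gamma> E f
  proof -
    have f: "f holomorphic_on unit_disk" and fin: "weighted_integral p \<alpha> unit_disk f < \<infinity>"
      using fB by (auto simp: bergman_space_def)
    define u where "u = bergman_integrand p \<alpha> f"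
    \<comment> \<open>For Tonelli the integrand restricted to \<open>E\<close> should be Borel, so \<open>E\<close> is replaced by a Borel subset of the same measure.\<close>
    obtain S N N' where S: "E = S \<union> N" "N \<subseteq> N'" "N' \<in> null_sets lborel" "S \<in> sets lborel"
      using sets_completionE[OF E] .
    have Sb: "S \<in> sets borel" and SD: "S \<subseteq> unit_disk" using S ED by auto
    have "pseudohyperbolic_dense \<gamma> r S"
    proof -
      have "measure lebesgue (E \<inter> D) = measure lebesgue (S \<inter> D)" if D: "D \<in> sets borel" for D
      proof (rule measure_eq_AE)
        have "AE z in lborel. z \<notin> N'" by (rule AE_not_in) (rule S)
        then have "AE z in lebesgue. z \<notin> N'" by (rule AE_completion)
        then show "AE z in lebesgue. z \<in> E \<inter> D \<longleftrightarrow> z \<in> S \<inter> D"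
          by eventually_elim (use S in auto)
        have DL: "D \<in> sets lebesgue" "S \<in> sets lebesgue"
          using D Sb by (metis sets_completionI_sets sets_lborel)+
        show "E \<inter> D \<in> sets lebesgue" using E DL by auto
        show "S \<inter> D \<in> sets lebesgue" using DL by auto
      qed
      then show ?thesis
        using dense pseudohyperbolic_disk_borel by (simp add: pseudohyperbolic_dense_def)
    qed
    define I where "I = (\<integral>\<^sup>+z. u z \<partial>lborel)"
    define J where "J = (\<integral>\<^sup>+z\<in>S. u z \<partial>lborel)"
    define \<nu> where "\<nu> = (\<alpha> + 1) / pi"
    have \<nu>: "\<nu> > 0" using assms by (simp add: \<nu>_def)
    have WD: "weighted_integral p \<alpha> unit_disk f = ennreal \<nu> * I"
      using weighted_integral_eq[OF assms(2) _ _ f, of unit_disk p]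
      by (simp add: \<nu>_def I_def u_def bergman_integrand_def mult.assoc flip: indicator_inter_arith)
    have WS: "weighted_integral p \<alpha> S f = ennreal \<nu> * J"
      using weighted_integral_eq[OF assms(2) Sb SD f, of p] by (simp add: \<nu>_def J_def u_def)
    have "I < \<infinity>" using fin \<nu> unfolding WD by (auto simp: ennreal_mult_less_top)
    then have "ennreal (c * \<gamma> powr L) * I \<le> J"
      using bound[rule_format, OF \<gamma> Sb f] \<open>pseudohyperbolic_dense \<gamma> r S\<close>
      unfolding I_def J_def u_def by blast
    then have "ennreal (c * \<gamma> powr L) * weighted_integral p \<alpha> unit_disk f \<le> weighted_integral p \<alpha> S f"
      unfolding WD WS by (metis mult.left_commute mult_left_mono zero_le)
    also have "\<dots> \<le> weighted_integral p \<alpha> E f"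
      unfolding weighted_integral_def using S(1) by (intro nn_integral_mono) (auto simp: indicator_def)
    finally have le: "ennreal (c * \<gamma> powr L) * weighted_integral p \<alpha> unit_disk f \<le> weighted_integral p \<alpha> E f" .
    have "weighted_integral p \<alpha> E f \<le> weighted_integral p \<alpha> unit_disk f"
      unfolding weighted_integral_def using ED by (intro nn_integral_mono) (auto simp: indicator_def)
    then have "weighted_integral p \<alpha> E f < top" using fin by (simp add: le_less_trans)
    then have "enn2real (ennreal (c * \<gamma> powr L) * weighted_integral p \<alpha> unit_disk f)
        \<le> enn2real (weighted_integral p \<alpha> E f)"
      using le by (intro enn2real_mono)
    then have "c * \<gamma> powr L * enn2real (weighted_integral p \<alpha> unit_disk f) \<le> enn2real (weighted_integral p \<alpha> E f)"
      using c by (simp add: enn2real_mult)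
    then have "(c * \<gamma> powr L * enn2real (weighted_integral p \<alpha> unit_disk f)) powr (1 / p)
        \<le> weighted_norm p \<alpha> E f"
      unfolding weighted_norm_def using c p by (intro powr_mono2) auto
    moreover have "(c * \<gamma> powr L * enn2real (weighted_integral p \<alpha> unit_disk f)) powr (1 / p)
        = (c * \<gamma> powr L) powr (1 / p) * bergman_norm p \<alpha> f"
      using c by (simp add: bergman_norm_def weighted_norm_def powr_mult)
    moreover have "(\<gamma> / k) powr (L / p) = (c * \<gamma> powr L) powr (1 / p)"
    proof -
      have "k powr L = c powr (- 1)" unfolding k_def powr_powr using L by simp
      also have "\<dots> = 1 / c" using c by (simp add: powr_minus_divide)
      finally have "k powr L = 1 / c" .
      then have "(\<gamma> / k) powr L = c * \<gamma> powr L" using \<gamma> k by (simp add: powr_divide)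
      then show ?thesis by (metis powr_powr times_divide_eq_right mult.right_neutral)
    qed
    ultimately show ?thesis by simp
  qed
  have "L / p > 0" using L p by simp
  with k main show ?thesis by blast
qed

end
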